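(* Let $$F(t,s,r;u)=\sum_{n\ge0}\Bigl(\sum_{\pi\in\mathfrak{S}_n}t^{\mathrm{des}(\pi)}s^{\mathrm{xdes}(\pi)}r^{\mathrm{fix}(\pi)}\Bigr)\frac{u^n}{(1-t)^{n+1}},$$ and for each $m\ge0$ let $$S_m(u)=\frac{\displaystyle\frac{\prod_{1\le j\le m}(1-uX_j)}{\prod_{0\le j\le m}(1-ruZ_j)}}{\displaystyle 1-\sum_{1\le l\le m}\frac{uX_l\prod_{1\le j\le l-1}(1-uX_j)}{\prod_{0\le j\le l-1}(1-uY_j)}},$$ expanded as a formal power series in $u$ (the coefficient of each $u^n$ is a polynomial in finitely many of the variables $X_j,Y_j,Z_j$ with coefficients in $\mathbb{Z}[r]$). Then, as formal power series in $t$ and $u$, $$F(t,s,r;u)=\sum_{m\ge0}t^m\rho(S_m(u)),$$ where $\rho$ is applied coefficientwise in $u$.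
   Context: $\mathfrak{S}_n$ is the set of permutations of $[n]$. For $\pi\in\mathfrak{S}_n$: $\mathrm{des}(\pi)=|\{i:\pi_i>\pi_{i+1}\}|$; $\mathrm{fix}(\pi)=|\{i:\pi_i=i\}|$; an index $i$ is a crossing descent if $\pi_i\ge i+1\ge\pi_{i+1}$, and $\mathrm{xdes}(\pi)$ is their number. Let $X_0,X_1,\dots,Y_0,Y_1,\dots,Z_0,Z_1,\dots$ be commuting variables. For a monomial $M$ in these variables, an index $i\ge0$ is effective in $M$ if (i) $M$ contains $Y_i$ or $Z_i$, and (ii) $M$ contains some $X_k$ with $k>i$ such that (iii) $M$ contains neither $Y_j$ nor $Z_j$ for every $j$ with $i<j<k$. Let $\mathrm{eff}(M)$ be the number of effective indices of $M$. The linear operator $\rho$ sends $cM$ (with $c$ a scalar coefficient in $\mathbb{Z}[[s,r,u]]$) to $c\,s^{\mathrm{eff}(M)}$, extended linearly to formal power series. For example $\rho(X_1X_2Y_0Y_3Z_0Z_1)=s^2$ and $\rho(X_3X_4Y_1Z_0^2)=s$. *)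

theory Defs
  imports "HOL-Library.Poly_Mapping" "HOL-Computational_Algebra.Formal_Power_Series"
          "HOL-Combinatorics.Permutations"
begin

definition des :: "nat \<Rightarrow> (nat \<Rightarrow> nat) \<Rightarrow> nat" where
  "des n \<pi> = card {i. 1 \<le> i \<and> i < n \<and> \<pi> i > \<pi> (i+1)}"

definition fixcount :: "nat \<Rightarrow> (nat \<Rightarrow> nat) \<Rightarrow> nat" where
  "fixcount n \<pi> = card {i. 1 \<le> i \<and> i \<le> n \<and> \<pi> i = i}"

definition xdes :: "nat \<Rightarrow> (nat \<Rightarrow> nat) \<Rightarrow> nat" where
  "xdes n \<pi> = card {i. 1 \<le> i \<and> i < n \<and> \<pi> i \<ge> i + 1 \<and> i + 1 \<ge> \<pi> (i+1)}"

datatype var = X nat | Y nat | Z nat | R | S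

type_synonym monom = "var \<Rightarrow>\<^sub>0 nat"
type_synonym mpoly = "monom \<Rightarrow>\<^sub>0 int"

definition V :: "var \<Rightarrow> mpoly" where
  "V v = Poly_Mapping.single (Poly_Mapping.single v 1) 1"

definition mono :: "monom \<Rightarrow> mpoly" where
  "mono M = Poly_Mapping.single M 1"

definition contains :: "monom \<Rightarrow> var \<Rightarrow> bool" where
  "contains M v \<longleftrightarrow> Poly_Mapping.lookup M v > 0"

definition effective :: "monom \<Rightarrow> nat \<Rightarrow> bool" where
  "effective M i \<longleftrightarrow>
     (contains M (Y i) \<or> contains M (Z i)) \<and>
     (\<exists>k>i. contains M (X k) \<and>
        (\<forall>j. i < j \<and> j < k \<longrightarrow> \<not> contains M (Y j) \<and> \<not> contains M (Z j)))"

definition eff :: "monom \<Rightarrow> nat" where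
  "eff M = card {i. effective M i}"

text \<open>rho: the coefficient c in Z[r] (the r-part of the monomial together with the
  integer coefficient) is kept, the X/Y/Z-part M is sent to s^eff(M).\<close>
definition rho :: "mpoly \<Rightarrow> mpoly" where
  "rho p = (\<Sum>M\<in>Poly_Mapping.keys p. of_int (Poly_Mapping.lookup p M) * V S ^ eff M * V R ^ Poly_Mapping.lookup M R)"

text \<open>Inverse of a power series with constant term 1 over a commutative ring.\<close>
definition recip :: "'a::comm_ring_1 fps \<Rightarrow> 'a fps" where
  "recip f = fps_right_inverse f 1"

definition cX :: "var \<Rightarrow> mpoly fps" where
  "cX v = fps_const (V v)"

definition Sm :: "nat \<Rightarrow> mpoly fps" where
  "Sm m =
    ((\<Prod>j\<in>{1..m}. 1 - fps_X * cX (X j)) * recip (\<Prod>j\<in>{0..m}. 1 - cX R * fps_X * cX (Z j)))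
    * recip (1 - (\<Sum>l\<in>{1..m}.
          fps_X * cX (X l) * (\<Prod>j\<in>{1..l-1}. 1 - fps_X * cX (X j))
            * recip (\<Prod>j\<in>{0..l-1}. 1 - fps_X * cX (Y j))))"

text \<open>F(t,s,r;u) as a power series in u whose coefficients are power series in t.\<close>
definition Fser :: "mpoly fps fps" where
  "Fser = Abs_fps (\<lambda>n.
     (\<Sum>\<pi>\<in>{\<pi>. \<pi> permutes {1..n}}.
        fps_X ^ des n \<pi> * fps_const (V S ^ xdes n \<pi> * V R ^ fixcount n \<pi>))
     * recip ((1 - fps_X) ^ (n + 1)))"

definition RHSser :: "mpoly fps fps" where
  "RHSser = Abs_fps (\<lambda>n. Abs_fps (\<lambda>m. rho (fps_nth (Sm m) n)))"

end

theory Submission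
  imports Defs "HOL-Library.Infinite_Set"
begin

text \<open>The coefficient of $t^m$ in $t^{des(\pi)}/(1-t)^{n+1}$ counts the sequences
  $m \ge d_1 \ge \dots \ge d_n \ge 0$ that drop strictly at the descents of $\pi$. Give position $i$ the
  variable $X_{d_i}$, $r Z_{d_i}$ or $Y_{d_i}$ according to whether $i$ is an excedance, a fixed point or
  an anti-excedance of $\pi$. Crossing descents then correspond to the effective indices of the
  resulting monomial, so it remains to show that the monomials of all pairs $(\pi, d)$ sum to the
  coefficient of $u^n$ in $S_m$.

  Colour position $i$ by the pair of $d_i$ and its type. Recording, for each colour $k$, the colours of the
  preimages under $\pi$ of the positions coloured $k$ turns the pair into a family of stacks in
  which every colour occurs as often as its own stack is long. Reading the stack of $k$ as the
  list of exits from a vertex $k$, such a family is an Eulerian system; popping the first exit of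
  the current vertex gives a linear system for the generating functions of trails ending at the
  largest colour, as in a proof of MacMahon's Master Theorem. Consecutive rows of the system
  differ in at most two entries, which makes it explicitly solvable.\<close>

section \<open>Balanced stacks\<close>

text \<open>The matrix entries see only colours, so \<open>i < p i\<close> and
  \<open>p i < i\<close> enter as weak inequalities between the colours of a position and its image,
  and a position sent into its own class can escape them. For allowed families this is repaired by
  one condition per class of excedance or anti-excedance colour: the head of its stack, suitably
  oriented, is not its own colour. Such a head is a loop, and forbidding loops of colour k at the
  head costs a factor 1 - u w_k. For excedances these factors form the numerator of S_m; for
  anti-excedances they cancel the factors 1 - uY_j that appear in the denominator for balanced
  families. No determinant is evaluated. Colours are added one at a time, and only trails ending at
  the newest, largest colour are solved for, so each colour multiplies the generating function by an
  explicit ratio. Colours of fixed points and anti-excedances are unreachable from smaller ones and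
  give geometric series; only an excedance colour requires solving the system.\<close>

definition confs :: "nat \<Rightarrow> nat \<Rightarrow> (nat \<Rightarrow> nat list) set" where
  "confs L n = {f. (\<forall>k\<ge>L. f k = []) \<and> (\<forall>k. set (f k) \<subseteq> {..<L}) \<and> (\<Sum>k<L. length (f k)) = n}"

definition cnt :: "nat \<Rightarrow> (nat \<Rightarrow> nat list) \<Rightarrow> nat \<Rightarrow> nat" where
  "cnt L f k = (\<Sum>j<L. count_list (f j) k)"

text \<open>Exits of \<open>k\<close> are listed in \<open>f k\<close>, so
  \<open>length (f k)\<close> is its out-degree and \<open>cnt L f k\<close> its in-degree. Only the
  degree condition of a trail from \<open>a\<close> to \<open>b\<close> is imposed; connectedness is
  not.\<close>

definition trails :: "nat \<Rightarrow> nat \<Rightarrow> nat \<Rightarrow> nat \<Rightarrow> (nat \<Rightarrow> nat list) set" where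
  "trails L a b n = {f \<in> confs L n. \<forall>k. length (f k) + of_bool (k = b) = cnt L f k + of_bool (k = a)}"

definition balanced :: "nat \<Rightarrow> nat \<Rightarrow> (nat \<Rightarrow> nat list) set" where
  "balanced L n = {f \<in> confs L n. \<forall>k. length (f k) = cnt L f k}"

text \<open>Colours are coded as numbers: \<open>3 * v\<close>, \<open>3 * v + 1\<close>, \<open>3 * v + 2\<close> stand for an excedance,
  a fixed point, an anti-excedance of value \<open>v\<close>. Colours weakly decrease along positions, so
  an excedance can only move to a position of the same or a smaller colour.\<close>

definition allow :: "nat \<Rightarrow> nat \<Rightarrow> bool" where
  "allow a j \<longleftrightarrow> (if j mod 3 = 0 then a \<le> j else if j mod 3 = 1 then a = j else j \<le> a)"

definition entry :: "(nat \<Rightarrow> 'a::comm_ring_1) \<Rightarrow> nat \<Rightarrow> nat \<Rightarrow> 'a" where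
  "entry w a j = (if allow a j then w j else 0)"

definition wt :: "(nat \<Rightarrow> 'a::comm_ring_1) \<Rightarrow> nat \<Rightarrow> (nat \<Rightarrow> nat list) \<Rightarrow> 'a" where
  "wt w L f = (\<Prod>k<L. prod_list (map (entry w k) (f k)))"

definition trail_gf :: "(nat \<Rightarrow> 'a::comm_ring_1) \<Rightarrow> nat \<Rightarrow> nat \<Rightarrow> nat \<Rightarrow> 'a fps" where
  "trail_gf w L a b = Abs_fps (\<lambda>n. \<Sum>f\<in>trails L a b n. wt w L f)"

definition balanced_gf :: "(nat \<Rightarrow> 'a::comm_ring_1) \<Rightarrow> nat \<Rightarrow> 'a fps" where
  "balanced_gf w L = Abs_fps (\<lambda>n. \<Sum>f\<in>balanced L n. wt w L f)"

definition strict_balanced :: "nat \<Rightarrow> nat set \<Rightarrow> nat \<Rightarrow> (nat \<Rightarrow> nat list) set" where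
  "strict_balanced L T n = {f \<in> balanced L n. \<forall>k\<in>T. f k = [] \<or> hd (f k) \<noteq> k}"

definition strict_gf :: "(nat \<Rightarrow> 'a::comm_ring_1) \<Rightarrow> nat \<Rightarrow> nat set \<Rightarrow> 'a fps" where
  "strict_gf w L T = Abs_fps (\<lambda>n. \<Sum>f\<in>strict_balanced L T n. wt w L f)"

lemma finite_confs: "finite (confs L n)"
proof (rule finite_subset)
  show "finite {f. \<forall>k. (k \<in> {..<L} \<longrightarrow> f k \<in> {xs. set xs \<subseteq> {..<L} \<and> length xs \<le> n})
      \<and> (k \<notin> {..<L} \<longrightarrow> f k = [])}"
    by (intro finite_set_of_finite_funs finite_lists_length_le) auto
  have "length (f k) \<le> n" if "f \<in> confs L n" "k < L" for f k
    using that member_le_sum[of k "{..<L}" "\<lambda>k. length (f k)"] by (auto simp: confs_def)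
  then show "confs L n \<subseteq> {f. \<forall>k. (k \<in> {..<L} \<longrightarrow> f k \<in> {xs. set xs \<subseteq> {..<L} \<and> length xs \<le> n})
      \<and> (k \<notin> {..<L} \<longrightarrow> f k = [])}"
    by (auto simp: confs_def)
qed

lemma finite_trails [simp]: "finite (trails L a b n)"
  by (rule finite_subset[OF _ finite_confs[of L n]]) (auto simp: trails_def)

lemma finite_balanced [simp]: "finite (balanced L n)"
  by (rule finite_subset[OF _ finite_confs[of L n]]) (auto simp: balanced_def)

lemma finite_strict_balanced [simp]: "finite (strict_balanced L T n)"
  by (rule finite_subset[OF _ finite_balanced[of L n]]) (auto simp: strict_balanced_def)

lemma trails_same: "trails L b b n = balanced L n"
  by (simp add: trails_def balanced_def)

lemma sum_push:
  fixes h :: "nat list \<Rightarrow> nat" and a L :: nat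
  assumes "a < L" "h (c # f a) = d + h (f a)"
  shows "(\<Sum>k<L. h ((f(a := c # f a)) k)) = d + (\<Sum>k<L. h (f k))"
proof -
  have "(\<Sum>k\<in>{..<L}-{a}. h ((f(a := c # f a)) k)) = (\<Sum>k\<in>{..<L}-{a}. h (f k))"
    by (intro sum.cong) auto
  moreover have a: "a \<in> {..<L}" using assms by simp
  ultimately show ?thesis
    unfolding sum.remove[OF finite_lessThan a] using assms(2) by simp
qed

lemma push_confs_iff:
  assumes "a < L" "c < L"
  shows "f(a := c # f a) \<in> confs L (Suc n) \<longleftrightarrow> f \<in> confs L n"
  using assms sum_push[of a L length c f 1] by (auto simp: confs_def subset_iff split: if_splits)

lemma cnt_push:
  assumes "a < L"
  shows "cnt L (f(a := c # f a)) k = of_bool (k = c) + cnt L f k"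
  unfolding cnt_def using assms by (intro sum_push) auto

lemma wt_push:
  assumes "a < L"
  shows "wt w L (f(a := c # f a)) = entry w a c * wt w L f"
proof -
  have "(\<Prod>k\<in>{..<L}-{a}. prod_list (map (entry w k) ((f(a := c # f a)) k)))
      = (\<Prod>k\<in>{..<L}-{a}. prod_list (map (entry w k) (f k)))"
    by (intro prod.cong) auto
  moreover have a: "a \<in> {..<L}" using assms by simp
  ultimately show ?thesis
    unfolding wt_def prod.remove[OF finite_lessThan a] by (simp add: mult.assoc)
qed

text \<open>Popping \<open>c\<close> lowers the out-degree of \<open>a\<close> and the in-degree of
  \<open>c\<close> by one, which is exactly the change in the degree condition when the start moves
  from \<open>a\<close> to \<open>c\<close>.\<close>

lemma push_trails_iff:
  assumes "a < L" "c < L"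
  shows "f(a := c # f a) \<in> trails L a b (Suc n) \<longleftrightarrow> f \<in> trails L c b n"
proof -
  have len: "length ((f(a := c # f a)) k) = length (f k) + of_bool (k = a)" for k
    by simp
  have "length ((f(a := c # f a)) k) + of_bool (k = b) = cnt L (f(a := c # f a)) k + of_bool (k = a)
    \<longleftrightarrow> length (f k) + of_bool (k = b) = cnt L f k + of_bool (k = c)" for k
    unfolding cnt_push[OF assms(1)] len
    by (rule iffI; linarith)
  then show ?thesis
    unfolding trails_def mem_Collect_eq push_confs_iff[OF assms] by blast
qed

lemma confs_push_cases:
  assumes "f \<in> confs L n" "f a \<noteq> []"
  obtains c g where "a < L" "c < L" "f = g(a := c # g a)" "c = hd (f a)" "g = f(a := tl (f a))"
proof -
  have "a < L" using assms by (cases "a < L") (auto simp: confs_def not_less)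
  moreover have "hd (f a) < L" 
  proof -
    have "set (f a) \<subseteq> {..<L}" using assms by (simp add: confs_def)
    then show ?thesis using hd_in_set[OF assms(2)] by blast
  qed
  moreover have "f = (f(a := tl (f a)))(a := hd (f a) # (f(a := tl (f a))) a)"
    using assms by auto
  ultimately show ?thesis using that by blast
qed

lemma sum_trails_nonempty:
  assumes "a < L"
  shows "(\<Sum>f\<in>{f \<in> trails L a b (Suc n). f a \<noteq> []}. wt w L f)
       = (\<Sum>c<L. entry w a c * (\<Sum>f\<in>trails L c b n. wt w L f))"
proof -
  have "(\<Sum>c<L. entry w a c * (\<Sum>f\<in>trails L c b n. wt w L f))
      = (\<Sum>c<L. \<Sum>f\<in>trails L c b n. entry w a c * wt w L f)"
    by (simp add: sum_distrib_left)
  also have "\<dots> = (\<Sum>(c,f)\<in>(SIGMA c:{..<L}. trails L c b n). entry w a c * wt w L f)"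
    by (subst sum.Sigma) auto
  also have "\<dots> = (\<Sum>f\<in>{f \<in> trails L a b (Suc n). f a \<noteq> []}. wt w L f)"
  proof (rule sum.reindex_bij_witness[of _ "\<lambda>g. (hd (g a), g(a := tl (g a)))"
        "\<lambda>(c,f). f(a := c # f a)"])
    fix p assume p: "p \<in> (SIGMA c:{..<L}. trails L c b n)"
    obtain c f where [simp]: "p = (c, f)" by (cases p)
    show "(case p of (c, f) \<Rightarrow> f(a := c # f a)) \<in> {f \<in> trails L a b (Suc n). f a \<noteq> []}"
      using p assms push_trails_iff[of a L c f b n] by simp
    show "(hd ((case p of (c, f) \<Rightarrow> f(a := c # f a)) a), (case p of (c, f) \<Rightarrow> f(a := c # f a))(a := tl ((case p of (c, f) \<Rightarrow> f(a := c # f a)) a))) = p"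
      by simp
    show "wt w L (case p of (c, f) \<Rightarrow> f(a := c # f a)) = (case p of (c, f) \<Rightarrow> entry w a c * wt w L f)"
      using assms by (simp add: wt_push)
  next
    fix g assume g: "g \<in> {f \<in> trails L a b (Suc n). f a \<noteq> []}"
    then have "g \<in> confs L (Suc n)" "g a \<noteq> []" by (auto simp: trails_def)
    then obtain c h where *: "a < L" "c < L" "g = h(a := c # h a)" "c = hd (g a)" "h = g(a := tl (g a))"
      by (rule confs_push_cases)
    have "h(a := c # h a) \<in> trails L a b (Suc n)"
      using g by (subst *(3)[symmetric]) simp
    then have "h \<in> trails L c b n" by (rule iffD1[OF push_trails_iff[OF assms *(2)]])
    then show "(hd (g a), g(a := tl (g a))) \<in> (SIGMA c:{..<L}. trails L c b n)"
      using *(2) unfolding *(4)[symmetric] *(5)[symmetric] by simp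
    show "(case (hd (g a), g(a := tl (g a))) of (c, f) \<Rightarrow> f(a := c # f a)) = g"
      using *(3) unfolding *(4)[symmetric] *(5)[symmetric] by simp
  qed
  finally show ?thesis ..
qed

lemma confs_drop_top:
  assumes "f \<in> confs (Suc b) n" "f b = []" "cnt (Suc b) f b = 0"
  shows "f \<in> confs b n"
proof -
  have "b \<notin> set (f j)" for j
  proof (cases "j < Suc b")
    case True
    then have "count_list (f j) b = 0" using assms(3) by (simp add: cnt_def del: sum.lessThan_Suc)
    then show ?thesis by (simp add: count_list_0_iff)
  qed (use assms(1) in \<open>auto simp: confs_def\<close>)
  moreover have "set (f j) \<subseteq> {..<Suc b}" for j using assms(1) by (auto simp: confs_def)
  ultimately have "set (f j) \<subseteq> {..<b}" for j by (force simp: less_Suc_eq)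
  moreover have "f k = []" if "k \<ge> b" for k
    using assms(1,2) that by (cases "k = b") (auto simp: confs_def)
  ultimately show ?thesis using assms(1,2) by (auto simp: confs_def)
qed

text \<open>Balance turns an empty stack at \<open>b\<close> into in-degree 0, so \<open>b\<close>
  occurs in no stack and the colour drops out altogether.\<close>

lemma balanced_empty:
  "{f \<in> balanced (Suc b) n. f b = []} = balanced b n"
proof -
  have c: "cnt (Suc b) f = cnt b f" if "f b = []" for f
    using that by (auto simp: cnt_def fun_eq_iff)
  have "f \<in> balanced b n" if "f \<in> balanced (Suc b) n" "f b = []" for f
  proof -
    have "length (f b) = cnt (Suc b) f b" using that(1) by (simp add: balanced_def)
    then have cnt0: "cnt (Suc b) f b = 0" unfolding that(2) by simp
    have bal: "f \<in> confs (Suc b) n" "\<forall>k. length (f k) = cnt (Suc b) f k"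
      using that(1) unfolding balanced_def by blast+
    have "f \<in> confs b n" by (rule confs_drop_top[OF bal(1) that(2) cnt0])
    then show ?thesis using bal(2) unfolding c[of f, OF that(2)] balanced_def by blast
  qed
  moreover have "f \<in> balanced (Suc b) n" "f b = []" if "f \<in> balanced b n" for f
  proof -
    have bal: "f \<in> confs b n" "\<forall>k. length (f k) = cnt b f k"
      using that unfolding balanced_def by blast+
    then show "f b = []" by (simp add: confs_def)
    have "set (f k) \<subseteq> {..<Suc b}" for k
      using bal(1) unfolding confs_def lessThan_Suc by blast
    then have "f \<in> confs (Suc b) n" using bal(1) by (auto simp: confs_def)
    then show "f \<in> balanced (Suc b) n"
      using bal(2) unfolding c[of f, OF \<open>f b = []\<close>, symmetric] balanced_def by blast
  qed
  ultimately show ?thesis by blast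
qed

lemma confs_0: "confs L 0 = {\<lambda>_. []}"
  by (auto simp: confs_def fun_eq_iff) (meson lessThan_iff not_le)

lemma trails_0: "trails L a b 0 = (if a = b then {\<lambda>_. []} else {})"
  by (auto simp: trails_def confs_0 cnt_def)

lemma balanced_0: "balanced L 0 = {\<lambda>_. []}"
  by (auto simp: balanced_def confs_0 cnt_def)

text \<open>Either the first exit of \<open>a\<close> is popped or its stack is empty. In the latter
  case the degree condition at \<open>a\<close> reads
  \<open>of_bool (a = b) = cnt (Suc b) f a + 1\<close>, so \<open>a = b\<close>; deleting this
  largest colour leaves the balanced families below \<open>b\<close> as inhomogeneous term.\<close>

lemma trail_gf_rec:
  assumes "a \<le> b"
  shows "trail_gf w (Suc b) a b
    = fps_X * (\<Sum>c\<le>b. fps_const (entry w a c) * trail_gf w (Suc b) c b)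
      + (if a = b then balanced_gf w b else 0)"
proof (rule fps_ext)
  fix n
  show "fps_nth (trail_gf w (Suc b) a b) n = fps_nth (fps_X * (\<Sum>c\<le>b. fps_const (entry w a c) * trail_gf w (Suc b) c b)
      + (if a = b then balanced_gf w b else 0)) n"
  proof (cases n)
    case 0
    then show ?thesis by (simp add: trail_gf_def balanced_gf_def trails_0 balanced_0 wt_def)
  next
    case (Suc n')
    have "(\<Sum>f\<in>trails (Suc b) a b n. wt w (Suc b) f)
      = (\<Sum>f\<in>{f \<in> trails (Suc b) a b n. f a \<noteq> []}. wt w (Suc b) f)
      + (\<Sum>f\<in>{f \<in> trails (Suc b) a b n. f a = []}. wt w (Suc b) f)"
      by (subst sum.union_disjoint[symmetric]) (auto intro!: sum.cong)
    also have "(\<Sum>f\<in>{f \<in> trails (Suc b) a b n. f a \<noteq> []}. wt w (Suc b) f)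
      = (\<Sum>c<Suc b. entry w a c * (\<Sum>f\<in>trails (Suc b) c b n'. wt w (Suc b) f))"
      unfolding Suc using assms by (intro sum_trails_nonempty) auto
    also have "(\<Sum>f\<in>{f \<in> trails (Suc b) a b n. f a = []}. wt w (Suc b) f)
      = (if a = b then (\<Sum>f\<in>balanced b n. wt w b f) else 0)"
    proof (cases "a = b")
      case True
      have "wt w (Suc b) f = wt w b f" if "f \<in> balanced b n" for f
        using that by (simp add: wt_def balanced_def confs_def)
      then show ?thesis using True by (simp add: trails_same balanced_empty)
    next
      case False
      have "f a \<noteq> []" if "f \<in> trails (Suc b) a b n" for f
      proof -
        have "length (f a) + of_bool (a = b) = cnt (Suc b) f a + of_bool (a = a)"
          using that unfolding trails_def by blast
        then show ?thesis using False by auto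
      qed
      then show ?thesis using False by (auto intro!: sum.neutral)
    qed
    finally show ?thesis
      by (simp add: trail_gf_def balanced_gf_def Suc fps_sum_nth lessThan_Suc_atMost)
  qed
qed

lemma trail_gf_same: "trail_gf w L b b = balanced_gf w L"
  by (simp add: trail_gf_def balanced_gf_def trails_same)

lemma balanced_gf_0: "balanced_gf w 0 = 1"
proof -
  have "balanced 0 n = (if n = 0 then {\<lambda>_. []} else {})" for n
    by (auto simp: balanced_def confs_def cnt_def)
  then show ?thesis by (auto simp: balanced_gf_def fps_eq_iff wt_def)
qed

section \<open>Loops at the head of a stack\<close>

lemma push_balanced_iff:
  assumes "a < L"
  shows "f(a := a # f a) \<in> balanced L (Suc n) \<longleftrightarrow> f \<in> balanced L n"
  using push_trails_iff[OF assms assms, of f a n] by (simp add: trails_same)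

text \<open>A loop adds one to both degrees of \<open>j\<close>. Removing it from the head of stack
  \<open>j\<close> maps the families that the new condition excludes bijectively to all families
  strict on \<open>T\<close>; as \<open>j \<notin> T\<close>, the head uncovered by the removal is
  unrestricted.\<close>

lemma strict_gf_insert:
  assumes "j < L" "j \<notin> T" "allow j j"
  shows "strict_gf w L (insert j T) = (1 - fps_X * fps_const (w j)) * strict_gf w L T"
proof -
  have "strict_gf w L T = strict_gf w L (insert j T) + fps_X * fps_const (w j) * strict_gf w L T"
  proof (rule fps_ext)
    fix n
    have *: "(\<Sum>f\<in>strict_balanced L T n. wt w L f) = (\<Sum>f\<in>strict_balanced L (insert j T) n. wt w L f)
      + (\<Sum>f\<in>{f \<in> strict_balanced L T n. f j \<noteq> [] \<and> hd (f j) = j}. wt w L f)"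
      by (subst sum.union_disjoint[symmetric])
        (auto intro!: sum.cong simp: strict_balanced_def)
    show "fps_nth (strict_gf w L T) n
      = fps_nth (strict_gf w L (insert j T) + fps_X * fps_const (w j) * strict_gf w L T) n"
    proof (cases n)
      case 0
      have "strict_balanced L U 0 = {\<lambda>_. []}" for U
        by (auto simp: strict_balanced_def balanced_0)
      then show ?thesis using 0 by (simp add: strict_gf_def)
    next
      case (Suc n')
      have "(\<Sum>f\<in>{f \<in> strict_balanced L T n. f j \<noteq> [] \<and> hd (f j) = j}. wt w L f)
        = (\<Sum>f\<in>strict_balanced L T n'. w j * wt w L f)"
      proof (rule sum.reindex_bij_witness[of _ "\<lambda>f. f(j := j # f j)" "\<lambda>g. g(j := tl (g j))"], goal_cases)
        case (1 g)
        then show ?case by (cases "g j") auto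
      next
        case (2 g)
        then have *: "g = (g(j := tl (g j)))(j := j # (g(j := tl (g j))) j)"
          by (cases "g j") auto
        have "g \<in> balanced L (Suc n')" using 2 by (simp add: strict_balanced_def Suc)
        then have "g(j := tl (g j)) \<in> balanced L n'"
          using push_balanced_iff[OF assms(1), of "g(j := tl (g j))" n'] * by metis
        then show ?case using 2 assms(2) by (auto simp: strict_balanced_def)
      next
        case (4 f)
        then show ?case using assms by (auto simp: strict_balanced_def Suc push_balanced_iff)
      next
        case (5 g)
        then have "g = (g(j := tl (g j)))(j := j # (g(j := tl (g j))) j)"
          by (cases "g j") auto
        then have "wt w L g = entry w j j * wt w L (g(j := tl (g j)))"
          using wt_push[OF assms(1)] by metis
        then show ?case using assms(3) by (simp add: entry_def)
      qed auto
      then show ?thesis using *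
        by (simp add: strict_gf_def Suc sum_distrib_left mult.assoc)
    qed
  qed
  then show ?thesis by (simp add: algebra_simps)
qed

lemma strict_gf_balanced_gf:
  assumes "T \<subseteq> {..<L}"
  shows "strict_gf w L T = (\<Prod>j\<in>T. 1 - fps_X * fps_const (w j)) * balanced_gf w L"
proof -
  have "finite T" using assms finite_subset by blast
  then show ?thesis using assms
  proof induction
    case empty
    show ?case by (simp add: strict_gf_def strict_balanced_def balanced_gf_def)
  next
    case (insert j T)
    moreover have "allow j j" by (simp add: allow_def)
    ultimately show ?case by (simp add: strict_gf_insert mult.assoc)
  qed
qed

section \<open>Generating functions of balanced stacks\<close>

lemma mult_recip:
  fixes f :: "'a::comm_ring_1 fps"
  assumes "fps_nth f 0 = 1"
  shows "f * recip f = 1"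
  unfolding recip_def by (rule fps_right_inverse) (simp add: assms)

lemma recip_unique:
  fixes f g :: "'a::comm_ring_1 fps"
  assumes "fps_nth f 0 = 1" "f * g = 1"
  shows "g = recip f"
proof -
  have "g = g * (f * recip f)" using mult_recip[OF assms(1)] by simp
  also have "\<dots> = (f * g) * recip f" by (simp add: ac_simps)
  finally show ?thesis using assms(2) by simp
qed

text \<open>Along increasing row index, an excedance column switches off just after its own colour,
  and an anti-excedance column switches on at its own colour. Between an anti-excedance row and the
  following excedance row neither happens.\<close>

lemma entry_Suc_eq:
  assumes "a mod 3 = 2"
  shows "entry w (Suc a) c = entry w a c"
proof -
  have "allow (Suc a) c \<longleftrightarrow> allow a c"
    unfolding allow_def using assms by presburger
  then show ?thesis by (simp add: entry_def)
qed

text \<open>Column \<open>a\<close>, of excedance or fixed-point colour, switches off after row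
  \<open>a\<close>, and column \<open>Suc a\<close>, of fixed-point or anti-excedance colour,
  switches on at row \<open>Suc a\<close>.\<close>

lemma entry_Suc_diff:
  assumes "a mod 3 \<noteq> 2"
  shows "entry w a c - entry w (Suc a) c
       = (if c = a then w a else 0) - (if c = Suc a then w (Suc a) else 0)"
proof -
  consider "c = a" | "c = Suc a" | "c \<noteq> a" "c \<noteq> Suc a" by blast
  then show ?thesis
  proof cases
    case 1
    then have "allow a c" "\<not> allow (Suc a) c" unfolding allow_def using assms by presburger+
    then show ?thesis using 1 by (simp add: entry_def)
  next
    case 2
    then have "\<not> allow a c" "allow (Suc a) c" unfolding allow_def using assms by presburger+
    then show ?thesis using 2 by (simp add: entry_def)
  next
    case 3
    then have "allow (Suc a) c \<longleftrightarrow> allow a c" unfolding allow_def by presburger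
    then show ?thesis using 3 by (simp add: entry_def)
  qed
qed

text \<open>No smaller colour can exit to \<open>b\<close>, so trails from below never reach it, and
  in an allowed balanced family stack \<open>b\<close> consists of loops only: a geometric
  series.\<close>

lemma balanced_gf_isolated:
  assumes "\<And>a. a < b \<Longrightarrow> \<not> allow a b"
  shows "balanced_gf w (Suc b) * (1 - fps_X * fps_const (w b)) = balanced_gf w b"
proof -
  have "fps_nth (trail_gf w (Suc b) a b) n = 0" if "a < b" for a n
    using that
  proof (induction n arbitrary: a)
    case 0
    then show ?case by (subst trail_gf_rec) auto
  next
    case (Suc n)
    have "entry w a c * fps_nth (trail_gf w (Suc b) c b) n = 0" if "c \<le> b" for c
      using that Suc assms[of a] by (cases "c = b") (auto simp: entry_def)
    then show ?case using Suc.prems by (subst trail_gf_rec) (auto simp: fps_sum_nth)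
  qed
  then have zero: "trail_gf w (Suc b) a b = 0" if "a < b" for a
    using that by (simp add: fps_eq_iff)
  have "(\<Sum>c\<le>b. fps_const (entry w b c) * trail_gf w (Suc b) c b)
      = (\<Sum>c\<le>b. if c = b then fps_const (w b) * balanced_gf w (Suc b) else 0)"
    by (intro sum.cong) (auto simp: zero trail_gf_same entry_def allow_def)
  then have "balanced_gf w (Suc b) = fps_X * (fps_const (w b) * balanced_gf w (Suc b)) + balanced_gf w b"
    using trail_gf_rec[of b b w] by (simp add: trail_gf_same)
  then show ?thesis by (simp add: algebra_simps)
qed

text \<open>The factor by which row \<open>3 * v\<close> of the trail system differs from row
  0.\<close>

definition step_frac :: "(nat \<Rightarrow> 'a::comm_ring_1) \<Rightarrow> nat \<Rightarrow> 'a fps" where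
  "step_frac w v = (\<Prod>j<v. (1 - fps_X * fps_const (w (3 * j))) * recip (1 - fps_X * fps_const (w (3 * j + 2))))"

text \<open>With the weights X, rZ, Y, \<open>denom w (Suc m)\<close> is the denominator of
  \<open>Sm m\<close> times 1 - uX_0.\<close>

definition denom :: "(nat \<Rightarrow> 'a::comm_ring_1) \<Rightarrow> nat \<Rightarrow> 'a fps" where
  "denom w m = 1 - (\<Sum>v<m. fps_X * fps_const (w (3 * v)) * step_frac w v)"

text \<open>The new largest colour \<open>3 * m\<close> is an excedance colour. All rows
  \<open>3 * v\<close> of its trail system are known multiples of row 0, and row 0 involves no other
  rows, so the system collapses to one scalar equation.\<close>

lemma balanced_gf_up:
  "balanced_gf w (3 * m + 1) * denom w (Suc m) = balanced_gf w (3 * m) * denom w m"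
proof -
  define b where "b = 3 * m"
  define N where "N a = trail_gf w (Suc b) a b" for a
  define row where "row a = fps_X * (\<Sum>c\<le>b. fps_const (entry w a c) * N c)" for a
  define M where "M = balanced_gf w b"
  have N: "N a = row a + (if a = b then M else 0)" if "a \<le> b" for a
    unfolding N_def row_def M_def using that by (rule trail_gf_rec)
  have row_eq: "row (Suc a) = row a" if "a mod 3 = 2" for a
    unfolding row_def entry_Suc_eq[OF that] ..
  have row_diff: "row a - row (Suc a)
      = fps_X * fps_const (w a) * N a - fps_X * fps_const (w (Suc a)) * N (Suc a)"
    if "a mod 3 \<noteq> 2" "Suc a \<le> b" for a
  proof -
    have "row a - row (Suc a) = fps_X * (\<Sum>c\<le>b. fps_const (entry w a c - entry w (Suc a) c) * N c)"
      unfolding row_def right_diff_distrib[symmetric] sum_subtractf[symmetric]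
        left_diff_distrib[symmetric] fps_const_sub ..
    also have "(\<Sum>c\<le>b. fps_const (entry w a c - entry w (Suc a) c) * N c)
      = (\<Sum>c\<le>b. (if c = a then fps_const (w a) * N a else 0)
           - (if c = Suc a then fps_const (w (Suc a)) * N (Suc a) else 0))"
      by (intro sum.cong refl) (auto simp: entry_Suc_diff[OF that(1)] simp flip: fps_const_neg)
    also have "\<dots> = fps_const (w a) * N a - fps_const (w (Suc a)) * N (Suc a)"
      using that(2) by (simp add: sum_subtractf)
    finally show ?thesis by (simp add: algebra_simps)
  qed
  have rowP: "row (3 * v) = step_frac w v * row 0" if "v \<le> m" for v
    using that
  proof (induction v)
    case 0
    then show ?case by (simp add: step_frac_def)
  next
    case (Suc v)
    let ?x = "1 - fps_X * fps_const (w (3 * v))" and ?y = "1 - fps_X * fps_const (w (3 * v + 2))"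
    have lt: "3 * v < b" "3 * v + 1 < b" "3 * v + 2 < b" using Suc.prems by (auto simp: b_def)
    have mod: "3 * v mod 3 \<noteq> 2" "(3 * v + 1) mod 3 \<noteq> 2" "(3 * v + 2) mod 3 = 2" by presburger+
    \<comment> \<open>Strictly below \<open>b\<close> the unknown \<open>N a\<close> equals
      \<open>row a\<close>, so the two-entry difference becomes a first-order recurrence. At
      \<open>b\<close> the term \<open>M\<close> enters, hence the condition
      \<open>Suc a < b\<close>.\<close>
    have step: "(1 - fps_X * fps_const (w a)) * row a = (1 - fps_X * fps_const (w (Suc a))) * row (Suc a)"
      if "a mod 3 \<noteq> 2" "Suc a < b" for a
      using row_diff[of a] that by (simp add: N algebra_simps)
    \<comment> \<open>On the way from excedance to anti-excedance colour the factor of the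
      fixed-point colour cancels; this keeps the Z variables out of \<open>denom\<close>.\<close>
    have "?x * row (3 * v) = ?y * row (3 * v + 2)"
      using step[OF mod(1)] step[OF mod(2)] lt by simp
    then have "recip ?y * (?x * row (3 * v)) = recip ?y * (?y * row (3 * v + 2))" by simp
    also have "\<dots> = (?y * recip ?y) * row (3 * v + 2)" by (simp only: ac_simps)
    also have "?y * recip ?y = 1" by (rule mult_recip) simp
    finally have "row (3 * v + 2) = ?x * recip ?y * row (3 * v)" by (simp only: ac_simps mult_1_left)
    moreover have "row (3 * Suc v) = row (3 * v + 2)" using row_eq[OF mod(3)] by (simp add: numeral_3_eq_3)
    ultimately show ?case using Suc by (simp add: step_frac_def mult.assoc mult.left_commute)
  qed
  \<comment> \<open>Row 0 has nonzero entries only in the excedance columns. There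
    \<open>N (3 * v)\<close> is \<open>step_frac w v * A\<close>, with the extra summand
    \<open>M\<close> in the last column, so \<open>A\<close> satisfies an equation in
    \<open>A\<close> and \<open>M\<close> alone.\<close>
  define A where "A = row 0"
  have Nm: "N b = step_frac w m * A + M" using N[of b] rowP[of m] by (simp add: b_def A_def)
  have "A = (\<Sum>c\<le>b. fps_X * (fps_const (entry w 0 c) * N c))"
    by (simp add: A_def row_def sum_distrib_left)
  also have "\<dots> = (\<Sum>c\<in>(\<lambda>v. 3 * v) ` {..m}. fps_X * (fps_const (entry w 0 c) * N c))"
  proof (rule sum.mono_neutral_right)
    show "\<forall>c\<in>{..b} - (\<lambda>v. 3 * v) ` {..m}. fps_X * (fps_const (entry w 0 c) * N c) = 0"
    proof
      fix c assume c: "c \<in> {..b} - (\<lambda>v. 3 * v) ` {..m}"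
      have "c mod 3 \<noteq> 0"
      proof
        assume "c mod 3 = 0"
        then have "c = 3 * (c div 3)" by presburger
        moreover have "c div 3 \<le> m" using c by (auto simp: b_def)
        ultimately show False using c by blast
      qed
      then have "\<not> allow 0 c" unfolding allow_def by presburger
      then show "fps_X * (fps_const (entry w 0 c) * N c) = 0" by (simp add: entry_def)
    qed
  qed (auto simp: b_def)
  also have "\<dots> = (\<Sum>v\<le>m. fps_X * (fps_const (w (3 * v)) * N (3 * v)))"
    by (subst sum.reindex) (auto simp: inj_on_def entry_def allow_def)
  also have "\<dots> = (\<Sum>v<m. fps_X * (fps_const (w (3 * v)) * N (3 * v))) + fps_X * (fps_const (w b) * N b)"
    by (simp add: b_def flip: lessThan_Suc_atMost)
  also have "(\<Sum>v<m. fps_X * (fps_const (w (3 * v)) * N (3 * v)))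
      = (\<Sum>v<m. fps_X * fps_const (w (3 * v)) * step_frac w v) * A"
    unfolding sum_distrib_right
    by (intro sum.cong) (simp_all add: N b_def rowP A_def mult.assoc)
  finally have A0: "A = (\<Sum>v<m. fps_X * fps_const (w (3 * v)) * step_frac w v) * A
      + fps_X * (fps_const (w b) * (step_frac w m * A + M))"
    unfolding Nm .
  have "denom w (Suc m) = 1 - (\<Sum>v<m. fps_X * fps_const (w (3 * v)) * step_frac w v)
      - fps_X * fps_const (w b) * step_frac w m"
    by (simp add: denom_def b_def)
  then have "A * denom w (Suc m) = A - (\<Sum>v<m. fps_X * fps_const (w (3 * v)) * step_frac w v) * A
      - fps_X * fps_const (w b) * step_frac w m * A"
    by (simp add: right_diff_distrib mult.commute)
  also have "\<dots> = fps_X * fps_const (w b) * M"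
    by (subst (1) A0) (simp add: distrib_left mult.assoc)
  finally have A: "A * denom w (Suc m) = fps_X * fps_const (w b) * M" .
  have "denom w m = denom w (Suc m) + fps_X * fps_const (w b) * step_frac w m"
    by (simp add: denom_def b_def)
  moreover have "N b * denom w (Suc m) = step_frac w m * (A * denom w (Suc m)) + M * denom w (Suc m)"
    by (simp add: Nm algebra_simps)
  ultimately have "N b * denom w (Suc m) = M * denom w m"
    unfolding A by (simp add: algebra_simps)
  then show ?thesis by (simp add: N_def M_def trail_gf_same b_def)
qed

text \<open>The colours \<open>3 * m\<close>, \<open>3 * m + 1\<close>, \<open>3 * m + 2\<close> are
  added in turn. The first replaces \<open>denom w m\<close> by \<open>denom w (Suc m)\<close>; each
  of the others is isolated when it is the largest, since it may occur only in stacks of its own or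
  a larger colour.\<close>

lemma balanced_gf_product:
  "balanced_gf w (3 * m) * denom w m
     * (\<Prod>j<m. (1 - fps_X * fps_const (w (3 * j + 1))) * (1 - fps_X * fps_const (w (3 * j + 2)))) = 1"
proof (induction m)
  case 0
  show ?case by (simp add: balanced_gf_0 denom_def)
next
  case (Suc m)
  have Z: "balanced_gf w (3 * m + 2) * (1 - fps_X * fps_const (w (3 * m + 1))) = balanced_gf w (3 * m + 1)"
    using balanced_gf_isolated[of "3 * m + 1" w] by (simp add: allow_def mod_Suc)
  have "\<not> allow a (3 * m + 2)" if "a < 3 * m + 2" for a
    unfolding allow_def using that by presburger
  then have Y: "balanced_gf w (3 * Suc m) * (1 - fps_X * fps_const (w (3 * m + 2))) = balanced_gf w (3 * m + 2)"
    using balanced_gf_isolated[of "3 * m + 2" w] by (simp add: numeral_3_eq_3)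
  let ?P = "\<Prod>j<m. (1 - fps_X * fps_const (w (3 * j + 1))) * (1 - fps_X * fps_const (w (3 * j + 2)))"
  have "balanced_gf w (3 * Suc m) * denom w (Suc m)
     * (\<Prod>j<Suc m. (1 - fps_X * fps_const (w (3 * j + 1))) * (1 - fps_X * fps_const (w (3 * j + 2))))
   = ((balanced_gf w (3 * Suc m) * (1 - fps_X * fps_const (w (3 * m + 2))))
      * (1 - fps_X * fps_const (w (3 * m + 1)))) * denom w (Suc m) * ?P"
    unfolding prod.lessThan_Suc by (simp only: ac_simps)
  also have "\<dots> = (balanced_gf w (3 * m + 1) * denom w (Suc m)) * ?P"
    unfolding Y Z ..
  also have "\<dots> = 1"
    unfolding balanced_gf_up using Suc.IH by simp
  finally show ?case .
qed

text \<open>Of the strictness factors, those of anti-excedance colours cancel against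
  \<open>balanced_gf_product\<close> and those of excedance colours remain as numerator. The
  fixed-point factors stay on the other side.\<close>

lemma strict_gf_product:
  assumes "T = {k. k < 3 * m \<and> k mod 3 \<noteq> 1}"
  shows "strict_gf w (3 * m) T * denom w m * (\<Prod>j<m. 1 - fps_X * fps_const (w (3 * j + 1)))
    = (\<Prod>j<m. 1 - fps_X * fps_const (w (3 * j)))"
proof -
  let ?g = "\<lambda>k. 1 - fps_X * fps_const (w k)"
  have "T = (\<lambda>j. 3 * j) ` {..<m} \<union> (\<lambda>j. 3 * j + 2) ` {..<m}" (is "_ = ?A \<union> ?B")
  proof (intro equalityI subsetI)
    fix k assume "k \<in> T"
    then have "k div 3 < m" "k = 3 * (k div 3) \<or> k = 3 * (k div 3) + 2"
      unfolding assms by (auto, presburger)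
    then show "k \<in> ?A \<union> ?B" by blast
  qed (auto simp: assms mod_Suc)
  moreover have "?A \<inter> ?B = {}" by (auto, presburger)
  ultimately have "prod ?g T = prod ?g ?A * prod ?g ?B" by (simp add: prod.union_disjoint)
  also have "\<dots> = (\<Prod>j<m. ?g (3 * j)) * (\<Prod>j<m. ?g (3 * j + 2))"
    by (simp add: prod.reindex inj_on_def)
  finally have T: "prod ?g T = (\<Prod>j<m. ?g (3 * j)) * (\<Prod>j<m. ?g (3 * j + 2))" .
  have sg: "strict_gf w (3 * m) T = prod ?g T * balanced_gf w (3 * m)"
    by (rule strict_gf_balanced_gf) (auto simp: assms)
  have "strict_gf w (3 * m) T * denom w m * (\<Prod>j<m. ?g (3 * j + 1))
    = (\<Prod>j<m. ?g (3 * j)) * (balanced_gf w (3 * m) * denom w m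
       * ((\<Prod>j<m. ?g (3 * j + 1)) * (\<Prod>j<m. ?g (3 * j + 2))))"
    unfolding sg T by (simp only: ac_simps)
  also have "\<dots> = (\<Prod>j<m. ?g (3 * j))"
    using balanced_gf_product[of w m] by (simp add: prod.distrib)
  finally show ?thesis .
qed

section \<open>Colourings and balanced stacks\<close>

text \<open>Positions of equal colour will have equal \<open>d\<close>, hence no descent among them.
  This monotonicity is what makes \<open>p\<close> recoverable from the colours of
  preimages.\<close>

definition class_increasing :: "nat \<Rightarrow> (nat \<Rightarrow> nat) \<Rightarrow> (nat \<Rightarrow> nat) \<Rightarrow> bool" where
  "class_increasing n c p \<longleftrightarrow> (\<forall>i\<in>{1..n}. \<forall>j\<in>{1..n}. i < j \<longrightarrow> c i = c j \<longrightarrow> p i < p j)"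

text \<open>Standardisation: the r-th position of colour \<open>k\<close> under \<open>c\<close> is
  sent to the r-th position of colour \<open>k\<close> under \<open>w\<close>, both classes being
  enumerated increasingly.\<close>

lemma class_increasing_exists:
  assumes "\<And>k. card {i \<in> {1..n}. c i = k} = card {i \<in> {1..n}. w i = k}"
  obtains p where "p permutes {1..n}" "\<And>i. i \<in> {1..n} \<Longrightarrow> w (p i) = c i" "class_increasing n c p"
proof -
  let ?C = "\<lambda>k. {i \<in> {1..n}. c i = k}" and ?D = "\<lambda>k. {i \<in> {1..n}. w i = k}"
  have "\<exists>g. bij_betw g (?C k) (?D k) \<and> strict_mono_on (?C k) g" for k
  proof -
    define a where "a = card (?C k)"
    obtain h where h: "bij_betw h {..<a} (?C k)" "strict_mono_on {..<a} h"
      unfolding a_def by (rule ex_bij_betw_strict_mono_card[of "?C k"]) auto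
    obtain h' where h': "bij_betw h' {..<a} (?D k)" "strict_mono_on {..<a} h'"
      unfolding a_def assms by (rule ex_bij_betw_strict_mono_card[of "?D k"]) auto
    let ?i = "the_inv_into {..<a} h"
    have bi: "bij_betw ?i (?C k) {..<a}"
      by (rule bij_betw_the_inv_into[OF h(1)])
    have "bij_betw (h' \<circ> ?i) (?C k) (?D k)"
      by (rule bij_betw_trans[OF bi h'(1)])
    moreover have "strict_mono_on (?C k) (h' \<circ> ?i)"
    proof (rule strict_mono_onI)
      fix x y assume xy: "x \<in> ?C k" "y \<in> ?C k" "x < y"
      have r: "?i x \<in> {..<a}" "?i y \<in> {..<a}"
        using bij_betwE[OF bi] xy(1,2) by blast+
      have e: "h (?i x) = x" "h (?i y) = y"
        using f_the_inv_into_f_bij_betw[OF h(1)] xy by auto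
      have "?i x < ?i y"
      proof (rule ccontr)
        assume "\<not> ?i x < ?i y"
        then have "h (?i y) \<le> h (?i x)"
          by (intro strict_mono_on_leD[OF h(2) r(2,1)]) (simp only: not_less)
        then show False unfolding e using xy(3) by simp
      qed
      then show "(h' \<circ> ?i) x < (h' \<circ> ?i) y"
        unfolding o_apply by (intro strict_mono_onD[OF h'(2) r])
    qed
    ultimately show ?thesis by blast
  qed
  then have "\<forall>k. \<exists>g. bij_betw g (?C k) (?D k) \<and> strict_mono_on (?C k) g" by blast
  from choice[OF this] obtain g where g0: "\<forall>k. bij_betw (g k) (?C k) (?D k) \<and> strict_mono_on (?C k) (g k)"
    by (rule exE)
  have g: "bij_betw (g k) (?C k) (?D k)" "strict_mono_on (?C k) (g k)" for k
    using spec[OF g0, of k] by (rule conjunct1, rule conjunct2)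
  define p where "p i = (if i \<in> {1..n} then g (c i) i else i)" for i
  have pD: "p i \<in> ?D (c i)" if "i \<in> {1..n}" for i
    using bij_betwE[OF g(1)[of "c i"]] that by (auto simp: p_def)
  have "inj_on p {1..n}"
  proof (rule inj_onI)
    fix i j assume ij: "i \<in> {1..n}" "j \<in> {1..n}" "p i = p j"
    then have "c i = c j" using pD[of i] pD[of j] by auto
    then show "i = j"
      using ij bij_betw_imp_inj_on[OF g(1)[of "c j"]] by (auto simp: p_def inj_on_def)
  qed
  moreover have "p ` {1..n} \<subseteq> {1..n}" using pD by auto
  ultimately have "bij_betw p {1..n} {1..n}"
    by (simp add: bij_betw_def endo_inj_surj)
  then have "p permutes {1..n}" by (rule bij_imp_permutes) (auto simp: p_def)
  moreover have "class_increasing n c p"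
    unfolding class_increasing_def
  proof (intro ballI impI)
    fix i j assume "i \<in> {1..n}" "j \<in> {1..n}" "i < j" "c i = c j"
    then show "p i < p j" using strict_mono_onD[OF g(2)[of "c j"], of i j] by (simp add: p_def)
  qed
  ultimately show ?thesis using pD by (intro that) auto
qed

text \<open>At a first disagreement \<open>p' i < q' i\<close>, the value \<open>p' i\<close> is
  taken by \<open>q'\<close> at some \<open>j\<close> of the same colour as \<open>i\<close>. Here
  \<open>j < i\<close> contradicts injectivity of \<open>p'\<close>, and \<open>j > i\<close>
  contradicts monotonicity of \<open>q'\<close> on the class.\<close>

lemma class_increasing_unique:
  assumes p: "p permutes {1..n}" "class_increasing n c p"
    and q: "q permutes {1..n}" "class_increasing n c q"
    and w: "\<And>i. i \<in> {1..n} \<Longrightarrow> w (p i) = c i" "\<And>i. i \<in> {1..n} \<Longrightarrow> w (q i) = c i"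
  shows "p = q"
proof -
  have le: "\<not> p' i < q' i"
    if "p' permutes {1..n}" "class_increasing n c p'" "q' permutes {1..n}" "class_increasing n c q'"
      "\<And>i. i \<in> {1..n} \<Longrightarrow> w (p' i) = c i" "\<And>i. i \<in> {1..n} \<Longrightarrow> w (q' i) = c i"
      "i \<in> {1..n}" "\<And>j. j < i \<Longrightarrow> p' j = q' j" for p' q' i
  proof
    assume lt: "p' i < q' i"
    define j where "j = inv q' (p' i)"
    have qj: "q' j = p' i" unfolding j_def using that(3) by (simp add: permutes_inverses)
    have j: "j \<in> {1..n}" unfolding j_def
      using that(1,3,7) by (metis permutes_in_image permutes_inv)
    have cj: "c j = c i" using that(5)[OF that(7)] that(6)[OF j] qj by simp
    have "j \<noteq> i" using qj lt by auto
    moreover have "\<not> i < j"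
      using that(4,7) j cj lt qj unfolding class_increasing_def by (metis less_asym)
    ultimately have "j < i" by simp
    then have "p' j = p' i" using that(8) qj by simp
    then show False using \<open>j \<noteq> i\<close> permutes_inj[OF that(1)] by (auto dest: injD)
  qed
  have "p i = q i" for i
  proof (induction i rule: less_induct)
    case (less i)
    show ?case
    proof (cases "i \<in> {1..n}")
      case True
      then show ?thesis
        using le[OF p q w True] le[OF q p w(2,1) True] less by (metis linorder_neqE_nat)
    next
      case False
      then show ?thesis using p(1) q(1) by (metis permutes_not_in)
    qed
  qed
  then show ?thesis by blast
qed

section \<open>Two-line arrays and their rows\<close>

definition row :: "nat \<Rightarrow> (nat \<times> nat) list \<Rightarrow> nat list" where
  "row k ps = map snd (filter (\<lambda>p. fst p = k) ps)"

lemma row_simps [simp]: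
  "row k [] = []"
  "row k ((a, b) # ps) = (if a = k then b # row k ps else row k ps)"
  "row k (ps @ qs) = row k ps @ row k qs"
  by (simp_all add: row_def)

lemma row_map_Pair: "row k (map (Pair a) xs) = (if a = k then xs else [])"
  by (induction xs) auto

lemma row_rev: "row k (rev ps) = rev (row k ps)"
  by (simp add: row_def rev_map rev_filter)

lemma filter_fst_row: "filter (\<lambda>p. fst p = k) ps = map (Pair k) (row k ps)"
  by (induction ps) auto

lemma sum_single_upd:
  fixes g :: "nat \<Rightarrow> nat"
  assumes "a < (L::nat)"
  shows "(\<Sum>k<L. if a = k then d + g k else g k) = d + (\<Sum>k<L. g k)"
proof -
  have "(\<Sum>k<L. if a = k then d + g k else g k) = (\<Sum>k<L. (if a = k then d else 0) + g k)"
    by (intro sum.cong) auto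
  then show ?thesis using assms by (simp add: sum.distrib)
qed

lemma sum_length_row:
  assumes "fst ` set ps \<subseteq> {..<L}"
  shows "(\<Sum>k<L. length (row k ps)) = length ps"
  using assms
proof (induction ps)
  case (Cons p ps)
  then show ?case
    using sum_single_upd[of "fst p" L 1 "\<lambda>k. length (row k ps)"]
    by (cases p) (simp add: if_distrib[of length] cong: if_cong)
qed simp

lemma sum_count_row:
  assumes "fst ` set ps \<subseteq> {..<L}"
  shows "(\<Sum>j<L. count_list (row j ps) k) = count_list (map snd ps) k"
  using assms
proof (induction ps)
  case (Cons p ps)
  obtain a b where p: "p = (a, b)" by (cases p)
  have "(\<Sum>j<L. count_list (row j (p # ps)) k)
    = (\<Sum>j<L. if a = j then of_bool (b = k) + count_list (row j ps) k else count_list (row j ps) k)"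
    by (intro sum.cong) (auto simp: p)
  also have "\<dots> = of_bool (b = k) + (\<Sum>j<L. count_list (row j ps) k)"
    using Cons.prems by (intro sum_single_upd) (auto simp: p)
  finally show ?case using Cons by (simp add: p)
qed simp

lemma prod_row:
  fixes g :: "nat \<Rightarrow> nat \<Rightarrow> 'a::comm_ring_1"
  assumes "fst ` set ps \<subseteq> {..<L}"
  shows "(\<Prod>k<L. prod_list (map (g k) (row k ps))) = prod_list (map (\<lambda>(a, b). g a b) ps)"
  using assms
proof (induction ps)
  case (Cons p ps)
  obtain a b where p: "p = (a, b)" by (cases p)
  have "(\<Prod>k<L. prod_list (map (g k) (row k (p # ps))))
    = (\<Prod>k<L. (if k = a then g a b else 1) * prod_list (map (g k) (row k ps)))"
    by (intro prod.cong) (auto simp: p)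
  also have "\<dots> = g a b * (\<Prod>k<L. prod_list (map (g k) (row k ps)))"
    using Cons.prems by (simp add: p prod.distrib)
  finally show ?case using Cons by (simp add: p)
qed simp

lemma length_row: "length (row k ps) = count_list (map fst ps) k"
  by (induction ps) auto

text \<open>Sorting by the first component is stable, so a sorted list is the stable sort of any
  list that has the same rows.\<close>

lemma sorted_rows_eq:
  assumes "sorted (map fst ps)" "sorted (map fst qs)" "\<And>k. row k ps = row k qs"
  shows "ps = qs"
proof -
  have filt: "filter (\<lambda>p. fst p = k) ps = filter (\<lambda>p. fst p = k) qs" for k
    by (simp add: filter_fst_row assms(3))
  have "count (mset ps) p = count (mset qs) p" for p
  proof -
    have "count (mset ps) p = count (mset (filter (\<lambda>q. fst q = fst p) ps)) p" for ps
      by simp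
    then show ?thesis using filt by metis
  qed
  then have "mset ps = mset qs" by (simp add: multiset_eq_iff)
  moreover have "filter (\<lambda>x. k = fst x) ps = filter (\<lambda>x. k = fst x) qs" for k
    using filt[of k] by (simp add: eq_commute)
  ultimately have "sort_key fst qs = ps"
    by (intro properties_for_sort_key) (use assms(1) in auto)
  then show ?thesis using sort_key_id_if_sorted[OF assms(2)] by simp
qed

lemma rsorted_rows_eq:
  assumes "sorted_wrt (\<ge>) (map fst ps)" "sorted_wrt (\<ge>) (map fst qs)" "\<And>k. row k ps = row k qs"
  shows "ps = qs"
proof -
  have "rev ps = rev qs"
    by (rule sorted_rows_eq) (use assms in \<open>simp_all add: rev_map[symmetric] sorted_wrt_rev row_rev\<close>)
  then show ?thesis by simp
qed

text \<open>A class of anti-excedance colour has its fixed points at its end, one of excedance colour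
  at its start. Reversing the stacks of the former puts both kinds of fixed point at the head
  of the stack, where strictness is tested.\<close>

definition orient :: "nat \<Rightarrow> 'a list \<Rightarrow> 'a list" where
  "orient k xs = (if k mod 3 = 2 then rev xs else xs)"

lemma orient_simps [simp]:
  "orient k (orient k xs) = xs" "length (orient k xs) = length xs" "set (orient k xs) = set xs"
  "count_list (orient k xs) x = count_list xs x" "orient k [] = []"
  "orient k xs = orient k ys \<longleftrightarrow> xs = ys"
  by (simp_all add: orient_def)

text \<open>The value 0 outside \<open>{1..n}\<close> makes \<open>c\<close> determined by its
  values on positions, as a bijection between sets of functions requires.\<close>

definition colorings :: "nat \<Rightarrow> nat \<Rightarrow> ((nat \<Rightarrow> nat) \<times> (nat \<Rightarrow> nat)) set" where
  "colorings n L = {(p, c). p permutes {1..n} \<and> (\<forall>i. i \<notin> {1..n} \<longrightarrow> c i = 0)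
     \<and> (\<forall>i\<in>{1..n}. c i < L) \<and> (\<forall>i\<in>{1..n}. \<forall>j\<in>{1..n}. i < j \<longrightarrow> c j \<le> c i)
     \<and> class_increasing n c p}"

text \<open>The second line holds the colours of preimages. For a colouring the first line is weakly
  decreasing, so the array can be restored from its rows.\<close>

definition biword :: "nat \<Rightarrow> (nat \<Rightarrow> nat) \<times> (nat \<Rightarrow> nat) \<Rightarrow> (nat \<times> nat) list" where
  "biword n = (\<lambda>(p, c). map (\<lambda>i. (c i, c (inv p i))) [1..<Suc n])"

definition stacks :: "nat \<Rightarrow> (nat \<Rightarrow> nat) \<times> (nat \<Rightarrow> nat) \<Rightarrow> nat \<Rightarrow> nat list" where
  "stacks n x k = orient k (row k (biword n x))"

lemma prod_list_orient:
  "prod_list (map (h :: _ \<Rightarrow> 'a::comm_ring_1) (orient k xs)) = prod_list (map h xs)"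
proof -
  have "prod_list (map h (rev xs)) = prod_list (map h xs)"
    by (induction xs) (simp_all add: mult.commute)
  then show ?thesis by (simp add: orient_def)
qed

lemma set_upt_1 [simp]: "set [1..<Suc n] = {1..n}"
  by auto

lemma mset_upt_1: "mset [1..<Suc n] = mset_set {1..n}"
  using mset_set_set[of "[1..<Suc n]"] unfolding set_upt_1 by simp

lemma count_list_mset: "count_list xs k = count (mset xs) k"
  by (induction xs) auto

lemma count_map_permutes:
  assumes "p permutes {1..n}"
  shows "count_list (map (c \<circ> p) [1..<Suc n]) k = count_list (map c [1..<Suc n]) k"
proof -
  have "mset (map (c \<circ> p) [1..<Suc n]) = mset (map c [1..<Suc n])"
    unfolding mset_map mset_upt_1 image_mset.compositionality[symmetric]
      permutes_image_mset[OF assms] ..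
  then show ?thesis by (simp only: count_list_mset)
qed

lemma count_list_map_card: "count_list (map c [1..<Suc n]) k = card {i \<in> {1..n}. c i = k}"
proof -
  have "count_list (map c [1..<Suc n]) k = length (filter (\<lambda>i. c i = k) [1..<Suc n])"
    unfolding count_list_eq_length_filter filter_map length_map by (simp add: o_def eq_commute)
  also have "\<dots> = card (set (filter (\<lambda>i. c i = k) [1..<Suc n]))"
    by (rule distinct_card[symmetric]) simp
  also have "set (filter (\<lambda>i. c i = k) [1..<Suc n]) = {i \<in> {1..n}. c i = k}"
    unfolding set_filter set_upt_1 by blast
  finally show ?thesis .
qed

lemma inv_in_range: "p permutes {1..n} \<Longrightarrow> i \<in> {1..n} \<Longrightarrow> inv p i \<in> {1..n::nat}"
  by (metis permutes_in_image permutes_inv)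

lemma stacks_balanced:
  assumes "x \<in> colorings n L"
  shows "stacks n x \<in> balanced L n"
proof -
  obtain p c where x: "x = (p, c)" by (cases x)
  have p: "p permutes {1..n}" and c: "\<And>i. i \<in> {1..n} \<Longrightarrow> c i < L"
    using assms by (auto simp: x colorings_def)
  have ci: "c (inv p i) < L" if "i \<in> {1..n}" for i
    using c inv_in_range[OF p that] by blast
  have set: "set (biword n x) \<subseteq> {..<L} \<times> {..<L}"
    unfolding biword_def x using c ci by (auto simp del: upt_Suc)
  have fst: "fst ` set (biword n x) \<subseteq> {..<L}" using set by auto
  have len: "length (biword n x) = n" by (simp add: biword_def x)
  have row_set: "set (row k (biword n x)) \<subseteq> {..<L}" for k using set by (auto simp: row_def)
  have "row k (biword n x) = []" if "k \<ge> L" for k using fst that by (force simp: row_def filter_empty_conv)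
  then have "stacks n x \<in> confs L n"
    using row_set sum_length_row[OF fst] len by (simp add: confs_def stacks_def)
  moreover have "length (stacks n x k) = cnt L (stacks n x) k" for k
  proof -
    have "map fst (biword n x) = map c [1..<Suc n]" "map snd (biword n x) = map (c \<circ> inv p) [1..<Suc n]"
      by (simp_all add: biword_def x)
    then show ?thesis
      using sum_count_row[OF fst, of k] count_map_permutes[OF permutes_inv[OF p], of c k]
      by (simp add: stacks_def cnt_def length_row del: upt_Suc)
  qed
  ultimately show ?thesis unfolding balanced_def by blast
qed

lemma wt_stacks:
  assumes "x = (p, c)" "x \<in> colorings n L"
  shows "wt w L (stacks n x) = (\<Prod>i\<in>{1..n}. entry w (c (p i)) (c i))"
proof -
  have p: "p permutes {1..n}" and c: "\<And>i. i \<in> {1..n} \<Longrightarrow> c i < L"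
    using assms by (auto simp: colorings_def)
  have fst: "fst ` set (biword n x) \<subseteq> {..<L}"
    unfolding biword_def assms(1) using c by (auto simp del: upt_Suc)
  have "wt w L (stacks n x) = prod_list (map (\<lambda>(a, b). entry w a b) (biword n x))"
    unfolding wt_def stacks_def prod_list_orient by (rule prod_row[OF fst])
  also have "\<dots> = prod_list (map (\<lambda>i. entry w (c i) (c (inv p i))) [1..<Suc n])"
    unfolding biword_def assms(1) by (simp add: o_def del: upt_Suc)
  also have "\<dots> = (\<Prod>i\<in>{1..n}. entry w (c i) (c (inv p i)))"
    using prod.distinct_set_conv_list[of "[1..<Suc n]" "\<lambda>i. entry w (c i) (c (inv p i))"]
    unfolding set_upt_1 by simp
  \<comment> \<open>Reindexing along \<open>p\<close> turns pairs (position, preimage) into pairs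
    (image, position).\<close>
  also have "\<dots> = (\<Prod>i\<in>{1..n}. entry w (c (p i)) (c (inv p (p i))))"
    using prod.permute[OF p, of "\<lambda>i. entry w (c i) (c (inv p i))"] by (simp add: o_def)
  also have "\<dots> = (\<Prod>i\<in>{1..n}. entry w (c (p i)) (c i))"
    by (simp add: permutes_inverses[OF p])
  finally show ?thesis .
qed

lemma biword_sorted:
  assumes "x \<in> colorings n L"
  shows "sorted_wrt (\<ge>) (map fst (biword n x))"
proof -
  obtain p c where x: "x = (p, c)" by (cases x)
  have c: "c j \<le> c i" if "i \<in> {1..n}" "j \<in> {1..n}" "i < j" for i j
    using assms that by (auto simp: x colorings_def)
  have "map fst (biword n x) = map c [1..<Suc n]" by (simp add: biword_def x)
  moreover have "sorted_wrt (\<ge>) (map c [1..<Suc n])"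
    unfolding sorted_wrt_map
    by (rule sorted_wrt_mono_rel[of _ "(<)"]) (use c in \<open>auto simp del: upt_Suc\<close>)
  ultimately show ?thesis by simp
qed

text \<open>The rows and the sorted first line give back the array, hence \<open>c\<close> and the
  colours of preimages; monotonicity on classes then singles out the permutation.\<close>

lemma stacks_inj: "inj_on (stacks n) (colorings n L)"
proof (rule inj_onI)
  fix x y assume x: "x \<in> colorings n L" and y: "y \<in> colorings n L" and eq: "stacks n x = stacks n y"
  obtain p c where xp: "x = (p, c)" by (cases x)
  obtain q d where yp: "y = (q, d)" by (cases y)
  have "row k (biword n x) = row k (biword n y)" for k
    using fun_cong[OF eq, of k] by (simp add: stacks_def)
  then have "biword n x = biword n y"
    by (rule rsorted_rows_eq[OF biword_sorted[OF x] biword_sorted[OF y]])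
  then have *: "c i = d i \<and> c (inv p i) = d (inv q i)" if "i \<in> {1..n}" for i
    using that unfolding biword_def xp yp by (auto simp del: upt_Suc simp: map_eq_conv)
  have "c = d"
  proof
    fix i show "c i = d i"
      using * x y by (cases "i \<in> {1..n}") (auto simp: xp yp colorings_def)
  qed
  moreover have "p = q"
  proof (rule class_increasing_unique[of p n c q "\<lambda>i. c (inv p i)"])
    show p: "p permutes {1..n}" and q: "q permutes {1..n}"
      and "class_increasing n c p" "class_increasing n c q"
      using x y by (auto simp: xp yp colorings_def \<open>c = d\<close>)
    show "c (inv p (p i)) = c i" for i by (simp add: permutes_inverses[OF p])
    show "c (inv p (q i)) = c i" if "i \<in> {1..n}" for i
    proof -
      have "q i \<in> {1..n}" using q that by (simp only: permutes_in_image)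
      then have "c (inv p (q i)) = d (inv q (q i))" using * by blast
      then show ?thesis by (simp add: permutes_inverses[OF q] \<open>c = d\<close>)
    qed
  qed
  ultimately show "x = y" by (simp add: xp yp)
qed

text \<open>Writing out the stacks in decreasing order of colour gives a two-line array. Balance
  says that both lines have the same content, which is the condition for a standardising permutation
  to exist.\<close>

lemma stacks_surj:
  assumes "f \<in> balanced L n"
  shows "f \<in> stacks n ` colorings n L"
proof -
  have f: "f \<in> confs L n" and bal: "\<And>k. length (f k) = cnt L f k"
    using assms unfolding balanced_def by blast+
  define ps where "ps = concat (map (\<lambda>k. map (Pair k) (orient k (f k))) (rev [0..<L]))"
  have gen: "row k (concat (map (\<lambda>k. map (Pair k) (orient k (f k))) (rev [0..<l])))
      = (if k < l then orient k (f k) else [])" for k l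
    by (induction l) (auto simp: row_map_Pair less_Suc_eq)
  have const: "sorted_wrt (\<ge>) (map (\<lambda>_. l) xs)" for l :: nat and xs :: "nat list"
    by (induction xs) auto
  have sorted: "sorted_wrt (\<ge>)
      (map fst (concat (map (\<lambda>k. map (Pair k) (orient k (f k))) (rev [0..<l]))))" for l
    by (induction l) (auto simp: sorted_wrt_append o_def const)
  have row: "row k ps = orient k (f k)" for k
    using gen[of k L] f by (auto simp: ps_def confs_def)
  have sorted: "sorted_wrt (\<ge>) (map fst ps)" unfolding ps_def by (rule sorted)
  have fst: "fst ` set ps \<subseteq> {..<L}" by (auto simp: ps_def)
  have len: "length ps = n"
    using sum_length_row[OF fst] f by (simp add: row confs_def)
  have count: "count_list (map fst ps) k = count_list (map snd ps) k" for k
    using sum_count_row[OF fst, of k] bal[of k] length_row[of k ps] by (simp add: row cnt_def)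
  define c where "c i = (if i \<in> {1..n} then fst (ps ! (i - 1)) else 0)" for i
  define v where "v i = snd (ps ! (i - 1))" for i
  have mc: "map c [1..<Suc n] = map fst ps" and mv: "map v [1..<Suc n] = map snd ps"
    by (auto intro!: nth_equalityI simp: len c_def v_def simp del: upt_Suc)
  obtain p where p: "p permutes {1..n}" "\<And>i. i \<in> {1..n} \<Longrightarrow> v (p i) = c i" "class_increasing n c p"
    using class_increasing_exists[of n c v] count
    unfolding mc[symmetric] mv[symmetric] count_list_map_card by metis
  have v: "c (inv p i) = v i" if "i \<in> {1..n}" for i
    using p(2)[OF inv_in_range[OF p(1) that]] permutes_inverses[OF p(1)] by simp
  have "map (\<lambda>i. (c i, c (inv p i))) [1..<Suc n] = ps"
    by (rule nth_equalityI) (auto simp: len v simp del: upt_Suc, auto simp: c_def v_def)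
  then have bw: "biword n (p, c) = ps" by (simp add: biword_def)
  have "c i < L" if "i \<in> {1..n}" for i
  proof -
    have "ps ! (i - 1) \<in> set ps" using that len by (intro nth_mem) auto
    then show ?thesis using fst that by (auto simp: c_def)
  qed
  moreover have "c j \<le> c i" if "i \<in> {1..n}" "j \<in> {1..n}" "i < j" for i j
    using sorted that unfolding sorted_wrt_map sorted_wrt_iff_nth_less by (auto simp: len c_def)
  ultimately have "(p, c) \<in> colorings n L"
    using p by (auto simp: colorings_def c_def)
  moreover have "stacks n (p, c) = f"
    by (rule ext) (simp add: stacks_def bw row)
  ultimately show ?thesis by blast
qed

lemma bij_betw_stacks: "bij_betw (stacks n) (colorings n L) (balanced L n)"
  unfolding bij_betw_def using stacks_inj stacks_balanced stacks_surj by blast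

section \<open>Excedance types read off the stacks\<close>

definition excedance_typed :: "nat \<Rightarrow> (nat \<Rightarrow> nat) \<Rightarrow> (nat \<Rightarrow> nat) \<Rightarrow> bool" where
  "excedance_typed n p c \<longleftrightarrow> (\<forall>i\<in>{1..n}. (c i mod 3 = 0 \<longrightarrow> i < p i)
     \<and> (c i mod 3 = 1 \<longrightarrow> p i = i) \<and> (c i mod 3 = 2 \<longrightarrow> p i < i))"

text \<open>Here \<open>i0\<close> and \<open>i1\<close> are the first and last position of the
  class; the orientation of the stack decides which of them its head describes.\<close>

lemma stacks_hd:
  assumes "x = (p, c)" "stacks n x k \<noteq> []"
  obtains i0 i1 where "i0 \<in> {1..n}" "c i0 = k" "i1 \<in> {1..n}" "c i1 = k"
    "\<And>i. i \<in> {1..n} \<Longrightarrow> c i = k \<Longrightarrow> i0 \<le> i \<and> i \<le> i1"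
    "hd (stacks n x k) = (if k mod 3 = 2 then c (inv p i1) else c (inv p i0))"
proof -
  define l where "l = filter (\<lambda>i. c i = k) [1..<Suc n]"
  have row: "row k (biword n x) = map (\<lambda>i. c (inv p i)) l"
    unfolding row_def biword_def assms(1) l_def prod.case filter_map map_map by (simp add: o_def)
  have ne: "l \<noteq> []" using assms(2) by (auto simp: stacks_def row)
  have set: "set l = {i \<in> {1..n}. c i = k}" unfolding l_def set_filter set_upt_1 by blast
  have "sorted l" unfolding l_def by (rule sorted_wrt_filter) (simp del: upt_Suc)
  then have "hd l \<le> i \<and> i \<le> last l" if "i \<in> set l" for i
    using that
  proof (induction l)
    case (Cons a l)
    then show ?case by (cases l) (auto simp: sorted_wrt.simps)
  qed simp
  moreover have "hd (stacks n x k) = (if k mod 3 = 2 then c (inv p (last l)) else c (inv p (hd l)))"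
    using ne by (simp add: stacks_def row orient_def hd_rev last_map hd_map)
  moreover have "hd l \<in> set l" "last l \<in> set l" using ne by auto
  ultimately show ?thesis using that[of "hd l" "last l"] unfolding set by blast
qed

lemma stacks_nonempty:
  assumes "x = (p, c)" "i \<in> {1..n}"
  shows "stacks n x (c i) \<noteq> []"
proof -
  have "(c i, c (inv p i)) \<in> set (biword n x)"
    unfolding biword_def assms(1) using assms(2) by (auto simp del: upt_Suc)
  then have "filter (\<lambda>p. fst p = c i) (biword n x) \<noteq> []" by (force simp: filter_empty_conv)
  then show ?thesis by (simp add: stacks_def orient_def row_def)
qed

context
  fixes n L :: nat and p c :: "nat \<Rightarrow> nat" and x
  assumes xpc: "x = (p, c)" and x: "x \<in> colorings n L"
begin

lemma coloring_perm: "p permutes {1..n}"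
  using x by (simp add: xpc colorings_def)

lemma coloring_antimono: "i \<in> {1..n} \<Longrightarrow> j \<in> {1..n} \<Longrightarrow> i \<le> j \<Longrightarrow> c j \<le> c i"
  using x by (cases "i = j") (auto simp: xpc colorings_def)

lemma coloring_increasing: "i \<in> {1..n} \<Longrightarrow> j \<in> {1..n} \<Longrightarrow> i \<le> j \<Longrightarrow> c i = c j \<Longrightarrow> p i \<le> p j"
  using x by (cases "i = j") (auto simp: xpc colorings_def class_increasing_def less_imp_le)

lemma coloring_range: "i \<in> {1..n} \<Longrightarrow> p i \<in> {1..n}"
  using coloring_perm by (simp only: permutes_in_image)

lemma coloring_interval:
  assumes "a \<in> {1..n}" "b \<in> {1..n}" "c a = c b" "i \<in> {a..b}"
  shows "i \<in> {1..n}" "c i = c a" "p a \<le> p i" "p i \<le> p b"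
proof -
  show i: "i \<in> {1..n}" using assms by auto
  show ci: "c i = c a"
    using coloring_antimono[of a i] coloring_antimono[of i b] i assms by auto
  show "p a \<le> p i" "p i \<le> p b"
    using coloring_increasing[of a i] coloring_increasing[of i b] i ci assms by auto
qed

text \<open>By finiteness, a monochromatic interval that is mapped into itself is mapped onto itself.\<close>

lemma coloring_interval_onto:
  assumes "a \<in> {1..n}" "b \<in> {1..n}" "c a = c b" "i \<in> {a..b}"
    and "\<And>j. j \<in> {a..b} \<Longrightarrow> p j \<in> {a..b}"
  shows "c (inv p i) = c a"
proof -
  have "inj_on p {a..b}" using permutes_inj_on[OF coloring_perm] .
  then have "p ` {a..b} = {a..b}" using assms(5) by (intro endo_inj_surj) auto
  then obtain j where j: "j \<in> {a..b}" "p j = i" using assms(4) by (metis imageE)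
  then have "inv p i = j" using permutes_inverses(2)[OF coloring_perm] by blast
  then show ?thesis using coloring_interval(2)[OF assms(1-3) j(1)] by simp
qed

text \<open>Suppose \<open>i\<close> has excedance colour but \<open>p i \<le> i\<close>. On
  \<open>{i0..i}\<close>, \<open>allow\<close> bounds \<open>p\<close> below by \<open>i0\<close>
  and monotonicity bounds it above by \<open>i\<close>, so the interval is mapped onto itself and
  the preimage of \<open>i0\<close> has the same colour, against strictness. Anti-excedances are the
  mirror image with \<open>i1\<close>. A fixed-point class is mapped into itself increasingly, hence
  identically.\<close>

lemma excedance_typed_if:
  assumes allow: "\<And>i. i \<in> {1..n} \<Longrightarrow> allow (c (p i)) (c i)"
    and strict: "\<And>k. k mod 3 \<noteq> 1 \<Longrightarrow> stacks n x k = [] \<or> hd (stacks n x k) \<noteq> k"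
  shows "excedance_typed n p c"
  unfolding excedance_typed_def
proof (intro ballI conjI impI)
  fix i assume i: "i \<in> {1..n}"
  obtain i0 i1 where i0: "i0 \<in> {1..n}" "c i0 = c i" and i1: "i1 \<in> {1..n}" "c i1 = c i"
    and between: "\<And>j. j \<in> {1..n} \<Longrightarrow> c j = c i \<Longrightarrow> i0 \<le> j \<and> j \<le> i1"
    and hd: "hd (stacks n x (c i)) = (if c i mod 3 = 2 then c (inv p i1) else c (inv p i0))"
    using stacks_hd[OF xpc stacks_nonempty[OF xpc i]] by blast
  have ne: "c i mod 3 \<noteq> 1 \<Longrightarrow> hd (stacks n x (c i)) \<noteq> c i"
    using strict[of "c i"] stacks_nonempty[OF xpc i] by blast
  have le: "i0 \<le> i" "i \<le> i1" using between[OF i] by auto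
  {
    assume mod: "c i mod 3 = 0"
    show "i < p i"
    proof (rule ccontr)
      assume pi: "\<not> i < p i"
      have "p j \<in> {i0..i}" if j: "j \<in> {i0..i}" for j
      proof -
        note J = coloring_interval[OF i0(1) i i0(2) j]
        have "c (p j) \<le> c i" using allow[OF J(1)] mod J(2) i0(2) by (simp add: allow_def)
        then have "i0 \<le> p j"
          using coloring_antimono[OF coloring_range[OF J(1)] i0(1)] i0(2)
            between[OF coloring_range[OF J(1)]] by (cases "p j \<le> i0") auto
        then show ?thesis using J(4) pi by auto
      qed
      then have "c (inv p i0) = c i"
        using coloring_interval_onto[OF i0(1) i i0(2), of i0] i0 le by simp
      then show False using ne hd mod by simp
    qed
  next
    assume mod: "c i mod 3 = 2"
    show "p i < i"
    proof (rule ccontr)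
      assume pi: "\<not> p i < i"
      have "p j \<in> {i..i1}" if j: "j \<in> {i..i1}" for j
      proof -
        note J = coloring_interval[OF i i1(1) i1(2)[symmetric] j]
        have "c i \<le> c (p j)" using allow[OF J(1)] mod J(2) by (simp add: allow_def)
        then have "p j \<le> i1"
          using coloring_antimono[OF i1(1) coloring_range[OF J(1)]] i1(2)
            between[OF coloring_range[OF J(1)]] by (cases "i1 \<le> p j") auto
        then show ?thesis using J(3) pi by auto
      qed
      then have "c (inv p i1) = c i"
        using coloring_interval_onto[OF i i1(1) i1(2)[symmetric], of i1] le by simp
      then show False using ne hd mod by simp
    qed
  next
    assume mod: "c i mod 3 = 1"
    have rng: "p j \<in> {i0..i1}" if "j \<in> {1..n}" "c j = c i" for j
    proof -
      have "c (p j) = c i" using allow[OF that(1)] mod that(2) by (simp add: allow_def)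
      then show ?thesis using between[OF coloring_range[OF that(1)]] by simp
    qed
    show "p i = i"
    proof (rule linorder_cases[of "p i" i])
      assume lt: "p i < i"
      \<comment> \<open>With \<open>p i < i\<close> the target is shorter than the source, which
        injectivity forbids.\<close>
      have "p ` {i0..i} \<subseteq> {i0..p i}"
      proof (rule image_subsetI)
        fix j assume j: "j \<in> {i0..i}"
        note J = coloring_interval[OF i0(1) i i0(2) j]
        show "p j \<in> {i0..p i}" using rng[OF J(1)] J(2,4) i0(2) by simp
      qed
      then have "card {i0..i} \<le> card {i0..p i}"
        by (intro card_inj_on_le[OF permutes_inj_on[OF coloring_perm]]) auto
      then show ?thesis using lt le by simp
    next
      assume lt: "p i > i"
      have "p ` {i..i1} \<subseteq> {p i..i1}"
      proof (rule image_subsetI)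
        fix j assume j: "j \<in> {i..i1}"
        note J = coloring_interval[OF i i1(1) i1(2)[symmetric] j]
        show "p j \<in> {p i..i1}" using rng[OF J(1,2)] J(3) by simp
      qed
      then have "card {i..i1} \<le> card {p i..i1}"
        by (intro card_inj_on_le[OF permutes_inj_on[OF coloring_perm]]) auto
      then show ?thesis using lt le by simp
    qed
  }
qed

lemma excedance_typed_allow:
  assumes "excedance_typed n p c" "i \<in> {1..n}"
  shows "allow (c (p i)) (c i)"
proof -
  have "c i mod 3 < 3" by simp
  then consider "c i mod 3 = 0" | "c i mod 3 = 1" | "c i mod 3 = 2" by linarith
  then show ?thesis
    using coloring_antimono[OF assms(2) coloring_range[OF assms(2)]]
      coloring_antimono[OF coloring_range[OF assms(2)] assms(2)]
      bspec[OF assms(1)[unfolded excedance_typed_def] assms(2)]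
    by cases (simp_all add: allow_def)
qed

text \<open>A head equal to \<open>k\<close> gives the extreme position \<open>e\<close> of the
  class a preimage \<open>j\<close> in that class. Then \<open>i0 = p j > j\<close> for excedances
  and \<open>i1 = p j < j\<close> for anti-excedances, although \<open>j\<close> lies between
  \<open>i0\<close> and \<open>i1\<close>.\<close>

lemma excedance_typed_strict:
  assumes "excedance_typed n p c" "k mod 3 \<noteq> 1"
  shows "stacks n x k = [] \<or> hd (stacks n x k) \<noteq> k"
proof (rule ccontr)
  assume *: "\<not> ?thesis"
  then obtain i0 i1 where i0: "i0 \<in> {1..n}" "c i0 = k" and i1: "i1 \<in> {1..n}" "c i1 = k"
    and between: "\<And>j. j \<in> {1..n} \<Longrightarrow> c j = k \<Longrightarrow> i0 \<le> j \<and> j \<le> i1"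
    and hd: "hd (stacks n x k) = (if k mod 3 = 2 then c (inv p i1) else c (inv p i0))"
    using stacks_hd[OF xpc, of n k] by blast
  define e where "e = (if k mod 3 = 2 then i1 else i0)"
  have e: "e \<in> {1..n}" "c (inv p e) = k" using * hd i0 i1 by (auto simp: e_def split: if_splits)
  define j where "j = inv p e"
  have j: "j \<in> {1..n}" "c j = k" "p j = e"
    unfolding j_def using e inv_in_range[OF coloring_perm] permutes_inverses(1)[OF coloring_perm] by auto
  have "i0 \<le> j" "j \<le> i1" using between[OF j(1,2)] by auto
  moreover have "k mod 3 = 0 \<or> k mod 3 = 2" using assms(2) by linarith
  ultimately show False
    using bspec[OF assms(1)[unfolded excedance_typed_def] j(1)] j(2,3)
    by (auto simp: e_def split: if_splits)
qed

end

text \<open>Strictness alone does not make a colouring typed, but a strict colouring that is not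
  typed violates \<open>allow\<close> at some position and so has weight 0.\<close>

lemma strict_gf_colorings:
  fixes w :: "nat \<Rightarrow> 'a::comm_ring_1"
  assumes T: "T = {k. k < L \<and> k mod 3 \<noteq> 1}"
  shows "fps_nth (strict_gf w L T) n
    = (\<Sum>(p, c)\<in>{(p, c) \<in> colorings n L. excedance_typed n p c}. \<Prod>i\<in>{1..n}. w (c i))"
proof -
  have strict: "stacks n x \<in> strict_balanced L T n \<longleftrightarrow>
      (\<forall>k. k mod 3 \<noteq> 1 \<longrightarrow> stacks n x k = [] \<or> hd (stacks n x k) \<noteq> k)"
    if "x \<in> colorings n L" for x
  proof -
    have bal: "stacks n x \<in> balanced L n" using stacks_balanced[OF that] .
    then have "stacks n x k = []" if "k \<ge> L" for k using that by (simp add: balanced_def confs_def)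
    then show ?thesis using bal unfolding strict_balanced_def T by (auto, metis not_le)
  qed
  have fin: "finite (colorings n L)"
    using bij_betw_finite[OF bij_betw_stacks[of n L]] by simp
  let ?S = "{x \<in> colorings n L. stacks n x \<in> strict_balanced L T n}"
  have "bij_betw (stacks n) ?S (strict_balanced L T n)"
    unfolding bij_betw_def
  proof
    show "inj_on (stacks n) ?S" by (rule inj_on_subset[OF stacks_inj]) auto
    have "strict_balanced L T n \<subseteq> balanced L n" by (auto simp: strict_balanced_def)
    then show "stacks n ` ?S = strict_balanced L T n" using stacks_surj by blast
  qed
  then have "fps_nth (strict_gf w L T) n = (\<Sum>x\<in>?S. wt w L (stacks n x))"
    by (simp add: strict_gf_def sum.reindex_bij_betw)
  also have "\<dots> = (\<Sum>x\<in>{(p, c) \<in> colorings n L. excedance_typed n p c}. wt w L (stacks n x))"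
  proof (rule sum.mono_neutral_right)
    show "finite ?S" using fin by simp
    show "{(p, c) \<in> colorings n L. excedance_typed n p c} \<subseteq> ?S"
    proof
      fix x assume "x \<in> {(p, c) \<in> colorings n L. excedance_typed n p c}"
      then obtain p c where pc: "x = (p, c)" "x \<in> colorings n L" "excedance_typed n p c" by blast
      then show "x \<in> ?S"
        using strict[OF pc(2)] excedance_typed_strict[OF pc] by blast
    qed
    show "\<forall>x\<in>?S - {(p, c) \<in> colorings n L. excedance_typed n p c}. wt w L (stacks n x) = 0"
    proof
      fix x assume x: "x \<in> ?S - {(p, c) \<in> colorings n L. excedance_typed n p c}"
      obtain p c where xpc: "x = (p, c)" by (cases x)
      have xc: "x \<in> colorings n L" and nt: "\<not> excedance_typed n p c" using x xpc by auto
      have "\<exists>i\<in>{1..n}. \<not> allow (c (p i)) (c i)"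
        using excedance_typed_if[OF xpc xc] strict[OF xc] x nt by blast
      then show "wt w L (stacks n x) = 0"
        unfolding wt_stacks[OF xpc xc] by (intro prod_zero) (auto simp: entry_def)
    qed
  qed
  also have "\<dots> = (\<Sum>(p, c)\<in>{(p, c) \<in> colorings n L. excedance_typed n p c}. \<Prod>i\<in>{1..n}. w (c i))"
  proof (rule sum.cong[OF refl])
    fix x assume "x \<in> {(p, c) \<in> colorings n L. excedance_typed n p c}"
    then obtain p c where pc: "x = (p, c)" "x \<in> colorings n L" "excedance_typed n p c" by blast
    have "wt w L (stacks n x) = (\<Prod>i\<in>{1..n}. w (c i))"
      unfolding wt_stacks[OF pc(1,2)]
      by (intro prod.cong) (simp_all add: entry_def excedance_typed_allow[OF pc])
    then show "wt w L (stacks n x) = (case x of (p, c) \<Rightarrow> \<Prod>i\<in>{1..n}. w (c i))"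
      by (simp add: pc(1))
  qed
  finally show ?thesis .
qed

section \<open>Compatible sequences\<close>

lemma recip_mult:
  fixes f g :: "'a::comm_ring_1 fps"
  assumes "fps_nth f 0 = 1" "fps_nth g 0 = 1"
  shows "recip (f * g) = recip f * recip g"
proof (rule recip_unique[symmetric])
  have "f * g * (recip f * recip g) = (f * recip f) * (g * recip g)" by (simp only: ac_simps)
  then show "f * g * (recip f * recip g) = 1" by (simp add: mult_recip assms)
qed (use assms in simp)

lemma recip_prod:
  fixes f :: "'b \<Rightarrow> 'a::comm_ring_1 fps"
  assumes "\<And>i. i \<in> A \<Longrightarrow> fps_nth (f i) 0 = 1"
  shows "recip (\<Prod>i\<in>A. f i) = (\<Prod>i\<in>A. recip (f i)) \<and> fps_nth (\<Prod>i\<in>A. f i) 0 = 1"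
  using assms
proof (induction A rule: infinite_finite_induct)
  case (insert x A)
  then show ?case by (simp add: recip_mult)
qed (simp_all add: recip_unique[of 1 1, symmetric])

section \<open>Specialising the weights to the series S_m\<close>

definition letter_weight :: "nat \<Rightarrow> mpoly" where
  "letter_weight k = (if k mod 3 = 0 then V (X (k div 3))
     else if k mod 3 = 1 then V R * V (Z (k div 3)) else V (Y (k div 3)))"

lemma letter_weight_simps [simp]:
  "letter_weight (3 * v) = V (X v)"
  "letter_weight (Suc (3 * v)) = V R * V (Z v)"
  "letter_weight (Suc (Suc (3 * v))) = V (Y v)"
proof -
  have "Suc (3 * v) div 3 = v" "Suc (3 * v) mod 3 = 1"
    "Suc (Suc (3 * v)) div 3 = v" "Suc (Suc (3 * v)) mod 3 = 2" by presburger+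
  then show "letter_weight (3 * v) = V (X v)" "letter_weight (Suc (3 * v)) = V R * V (Z v)"
    "letter_weight (Suc (Suc (3 * v))) = V (Y v)"
    by (simp_all add: letter_weight_def)
qed

text \<open>The factor 1 - uX_0 occurs in the numerator and throughout the denominator and cancels,
  which is why \<open>Sm\<close> has no \<open>X 0\<close>. Combinatorially, an excedance of value 0
  would be followed by values 0 only, hence by no descent, and \<open>p\<close> would exceed
  \<open>n\<close> at the end.\<close>

lemma strict_gf_Sm:
  assumes T: "T = {k. k < 3 * Suc m \<and> k mod 3 \<noteq> 1}"
  shows "strict_gf letter_weight (3 * Suc m) T = Sm m"
proof -
  define x where "x j = 1 - fps_X * cX (X j)" for j
  define y where "y j = 1 - fps_X * cX (Y j)" for j
  define z where "z j = 1 - cX R * fps_X * cX (Z j)" for j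
  have z': "z j = 1 - fps_X * fps_const (V R * V (Z j))" for j
    by (simp add: z_def cX_def ac_simps)
  define Q where "Q l = (\<Prod>j\<in>{1..l-1}. x j) * recip (\<Prod>j\<in>{0..l-1}. y j)" for l
  define G where "G = 1 - (\<Sum>l\<in>{1..m}. fps_X * cX (X l) * Q l)"
  have zero: "fps_nth (x j) 0 = 1" "fps_nth (y j) 0 = 1" "fps_nth (z j) 0 = 1" for j
    by (simp_all add: x_def y_def z')
  \<comment> \<open>For \<open>l \<ge> 1\<close> the factor \<open>x 0\<close> splits off. At
    \<open>l = 0\<close> the fraction is 1, and its summand uX_0 combines with the leading 1 to give
    \<open>x 0\<close> as well.\<close>
  have frac: "step_frac letter_weight l = x 0 * Q l" if "l \<ge> 1" for l
  proof -
    have sets: "{..<l} = {0..l-1}" "{0..l-1} = insert 0 {1..l-1}" using that by auto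
    have "step_frac letter_weight l = (\<Prod>j<l. x j * recip (y j))"
      by (simp add: step_frac_def x_def y_def cX_def)
    also have "\<dots> = (\<Prod>j<l. x j) * recip (\<Prod>j<l. y j)"
      using recip_prod[of "{..<l}" y] zero by (simp add: prod.distrib)
    also have "(\<Prod>j<l. x j) = x 0 * (\<Prod>j\<in>{1..l-1}. x j)"
      unfolding sets by simp
    finally show ?thesis unfolding sets(1) Q_def by (simp only: mult.assoc)
  qed
  have "(\<Sum>v<Suc m. fps_X * fps_const (letter_weight (3 * v)) * step_frac letter_weight v)
      = fps_X * cX (X 0) + (\<Sum>v\<in>{1..m}. fps_X * cX (X v) * step_frac letter_weight v)"
  proof -
    have "{..<Suc m} = insert 0 {1..m}" by auto
    then show ?thesis by (simp add: cX_def step_frac_def)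
  qed
  also have "(\<Sum>v\<in>{1..m}. fps_X * cX (X v) * step_frac letter_weight v)
      = x 0 * (\<Sum>v\<in>{1..m}. fps_X * cX (X v) * Q v)"
    unfolding sum_distrib_left by (intro sum.cong) (simp_all add: frac ac_simps)
  finally have denom: "denom letter_weight (Suc m) = x 0 * G"
    by (simp add: denom_def G_def right_diff_distrib x_def)
  have set0: "{..<Suc m} = {0..m}" by auto
  have set1: "{0..m} = insert 0 {1..m}" by auto
  define F where "F = strict_gf letter_weight (3 * Suc m) T"
  have "F * denom letter_weight (Suc m) * (\<Prod>j<Suc m. 1 - fps_X * fps_const (letter_weight (3 * j + 1)))
      = (\<Prod>j<Suc m. 1 - fps_X * fps_const (letter_weight (3 * j)))"
    unfolding F_def by (rule strict_gf_product[OF T])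
  also have "(\<Prod>j<Suc m. 1 - fps_X * fps_const (letter_weight (3 * j + 1))) = (\<Prod>j\<in>{0..m}. z j)"
    unfolding set0 by (simp add: z')
  also have "(\<Prod>j<Suc m. 1 - fps_X * fps_const (letter_weight (3 * j))) = x 0 * (\<Prod>j\<in>{1..m}. x j)"
    unfolding set0 set1 by (simp add: x_def cX_def)
  finally have eq: "F * (x 0 * G) * (\<Prod>j\<in>{0..m}. z j) = x 0 * (\<Prod>j\<in>{1..m}. x j)"
    unfolding denom .
  have rx: "x 0 * recip (x 0) = 1" by (rule mult_recip) (rule zero)
  have rz: "(\<Prod>j\<in>{0..m}. z j) * recip (\<Prod>j\<in>{0..m}. z j) = 1"
    using recip_prod[of "{0..m}" z] zero by (intro mult_recip) blast
  have rG: "G * recip G = 1"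
    by (rule mult_recip) (simp add: G_def fps_sum_nth mult.assoc)
  have "F = F * (x 0 * recip (x 0)) * (G * recip G)
      * ((\<Prod>j\<in>{0..m}. z j) * recip (\<Prod>j\<in>{0..m}. z j))"
    unfolding rx rz rG by simp
  also have "\<dots> = (F * (x 0 * G) * (\<Prod>j\<in>{0..m}. z j)) * (recip (x 0) * recip G * recip (\<Prod>j\<in>{0..m}. z j))"
    by (simp only: ac_simps)
  also have "\<dots> = (x 0 * recip (x 0)) * ((\<Prod>j\<in>{1..m}. x j) * recip (\<Prod>j\<in>{0..m}. z j) * recip G)"
    unfolding eq by (simp only: ac_simps)
  also have "\<dots> = Sm m"
    unfolding rx by (simp add: Sm_def x_def y_def z_def G_def Q_def mult.assoc)
  finally show ?thesis unfolding F_def .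
qed

section \<open>Compatible sequences as excedance-typed colourings\<close>

definition compatible :: "nat \<Rightarrow> nat \<Rightarrow> (nat \<Rightarrow> nat) \<Rightarrow> (nat \<Rightarrow> nat) set" where
  "compatible n m p = {d. (\<forall>i. i \<notin> {1..n} \<longrightarrow> d i = 0) \<and> (\<forall>i\<in>{1..n}. d i \<le> m)
     \<and> (\<forall>i. 1 \<le> i \<and> i < n \<longrightarrow> d (i + 1) \<le> d i \<and> (p i > p (i + 1) \<longrightarrow> d (i + 1) < d i))}"

text \<open>Where \<open>d\<close> is constant there is no descent, so \<open>p\<close> gains at
  least 1 per step and \<open>p i - i\<close> weakly increases. The inequality is stated additively
  to avoid truncated subtraction.\<close>

lemma compatible_chain:
  assumes "p permutes {1..n}" "d \<in> compatible n m p" "1 \<le> i" "i \<le> j" "j \<le> n"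
  shows "d j \<le> d i \<and> (d i = d j \<longrightarrow> p i + j \<le> p j + i)"
  using assms(4,5)
proof (induction j rule: dec_induct)
  case (step j)
  have j: "1 \<le> j" "j < n" using step assms(3) by auto
  have d: "d (j + 1) \<le> d j" "p j > p (j + 1) \<longrightarrow> d (j + 1) < d j"
    using assms(2) j unfolding compatible_def by blast+
  have "p j \<noteq> p (j + 1)" using injD[OF permutes_inj[OF assms(1)], of j "j + 1"] by linarith
  moreover have "d j \<le> d i" "d i = d j \<longrightarrow> p i + j \<le> p j + i" using step.IH j by linarith+
  ultimately have "d (j + 1) \<le> d i \<and> (d i = d (j + 1) \<longrightarrow> p i + (j + 1) \<le> p (j + 1) + i)"
    using d by linarith
  then show ?case by simp
qed simp

definition position_type :: "(nat \<Rightarrow> nat) \<Rightarrow> nat \<Rightarrow> nat" where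
  "position_type p i = (if i < p i then 0 else if p i = i then 1 else 2)"

definition coloring :: "nat \<Rightarrow> (nat \<Rightarrow> nat) \<Rightarrow> (nat \<Rightarrow> nat) \<Rightarrow> nat \<Rightarrow> nat" where
  "coloring n p d i = (if i \<in> {1..n} then 3 * d i + position_type p i else 0)"

lemma position_type_less: "position_type p i < 3"
  by (simp add: position_type_def)

lemma coloring_div_mod:
  assumes "i \<in> {1..n}"
  shows "coloring n p d i div 3 = d i" "coloring n p d i mod 3 = position_type p i"
  using assms position_type_less[of p i] by (simp_all add: coloring_def)

text \<open>On a block of constant \<open>d\<close> the difference \<open>p i - i\<close> weakly
  increases, so anti-excedances precede fixed points and these precede excedances. The type codes 2,
  1, 0 are chosen so that colours weakly decrease along the block.\<close>

lemma coloring_typed: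
  assumes p: "p permutes {1..n}" and d: "d \<in> compatible n m p"
  shows "(p, coloring n p d) \<in> colorings n (3 * Suc m)" "excedance_typed n p (coloring n p d)"
proof -
  let ?c = "coloring n p d"
  have mono: "?c j \<le> ?c i \<and> (?c i = ?c j \<longrightarrow> p i < p j)" if "i \<in> {1..n}" "j \<in> {1..n}" "i < j" for i j
  proof -
    have ch: "d j \<le> d i" "d i = d j \<longrightarrow> p i + j \<le> p j + i"
      using compatible_chain[OF p d, of i j] that by auto
    have pt: "position_type p i < 3" "position_type p j < 3" by (rule position_type_less)+
    show ?thesis
    proof (cases "d i = d j")
      case True
      then have "p i + j \<le> p j + i" using ch by blast
      moreover from this have "position_type p j \<le> position_type p i"
        using that by (auto simp: position_type_def)
      ultimately show ?thesis using True that by (simp add: coloring_def)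
    next
      case False
      then have "d j < d i" using ch by simp
      then have "?c j < ?c i" using that pt by (simp add: coloring_def)
      then show ?thesis by simp
    qed
  qed
  have "?c i < 3 * Suc m" if "i \<in> {1..n}" for i
  proof -
    have "d i \<le> m" using d that by (auto simp: compatible_def)
    then show ?thesis using that position_type_less[of p i] by (simp add: coloring_def)
  qed
  then show "(p, ?c) \<in> colorings n (3 * Suc m)"
    using p mono unfolding colorings_def class_increasing_def
    by (auto simp: coloring_def)
  show "excedance_typed n p ?c"
    unfolding excedance_typed_def by (simp add: coloring_div_mod position_type_def)
qed

lemma typed_coloring_div:
  assumes c: "(p, c) \<in> colorings n (3 * Suc m)" and t: "excedance_typed n p c"
  shows "(\<lambda>i. c i div 3) \<in> compatible n m p" "coloring n p (\<lambda>i. c i div 3) = c"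
proof -
  have tp: "(c i mod 3 = 0 \<longrightarrow> i < p i) \<and> (c i mod 3 = 1 \<longrightarrow> p i = i) \<and> (c i mod 3 = 2 \<longrightarrow> p i < i)"
    if "i \<in> {1..n}" for i
    using t that unfolding excedance_typed_def by (rule bspec)
  have pt: "position_type p i = c i mod 3" if "i \<in> {1..n}" for i
  proof -
    have "c i mod 3 = 0 \<or> c i mod 3 = 1 \<or> c i mod 3 = 2" by presburger
    then show ?thesis using tp[OF that] by (auto simp: position_type_def)
  qed
  show "coloring n p (\<lambda>i. c i div 3) = c"
    using c by (auto simp: coloring_def pt colorings_def fun_eq_iff)
  have "c i div 3 \<le> m" if "i \<in> {1..n}" for i
  proof -
    have "c i < 3 * Suc m" using c that by (auto simp: colorings_def)
    then show ?thesis by presburger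
  qed
  moreover have "c (i + 1) div 3 \<le> c i div 3 \<and> (p i > p (i + 1) \<longrightarrow> c (i + 1) div 3 < c i div 3)"
    if "1 \<le> i" "i < n" for i
  proof -
    have in_range: "i \<in> {1..n}" "i + 1 \<in> {1..n}" using that by auto
    have le: "c (i + 1) \<le> c i" and inc: "c i = c (i + 1) \<longrightarrow> p i < p (i + 1)"
      using c in_range by (auto simp: colorings_def class_increasing_def)
    have "c (i + 1) div 3 < c i div 3" if "p i > p (i + 1)"
    proof (rule ccontr)
      assume "\<not> ?thesis"
      \<comment> \<open>With equal values the colours must differ, since equal colours would exclude
        the descent. So the type code drops from \<open>i\<close> to \<open>i + 1\<close>, which
        means \<open>p i \<le> i < i + 1 \<le> p (i + 1)\<close> and rules out the descent after
        all.\<close>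
      then have "c (i + 1) div 3 = c i div 3" using div_le_mono[OF le, of 3] by simp
      moreover have "c (i + 1) < c i" using le inc that by linarith
      ultimately have "c (i + 1) mod 3 < c i mod 3" by presburger
      moreover have "c i mod 3 < 3" by simp
      ultimately have "c i mod 3 = 1 \<or> c i mod 3 = 2" "c (i + 1) mod 3 = 0 \<or> c (i + 1) mod 3 = 1" by linarith+
      then have "p i \<le> i" "i + 1 \<le> p (i + 1)" using tp[OF in_range(1)] tp[OF in_range(2)] by linarith+
      then show False using that by linarith
    qed
    then show ?thesis using div_le_mono[OF le] by blast
  qed
  moreover have "c i div 3 = 0" if "i \<notin> {1..n}" for i
    using c that by (auto simp: colorings_def)
  ultimately show "(\<lambda>i. c i div 3) \<in> compatible n m p"
    unfolding compatible_def by blast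
qed

lemma finite_compatible [simp]: "finite (compatible n m p)"
proof (rule finite_subset)
  show "finite {d. \<forall>i. (i \<in> {1..n} \<longrightarrow> d i \<in> {..m}) \<and> (i \<notin> {1..n} \<longrightarrow> d i = (0::nat))}"
    by (rule finite_set_of_finite_funs) auto
qed (auto simp: compatible_def)

lemma Sm_nth:
  "fps_nth (Sm m) n = (\<Sum>p | p permutes {1..n}. \<Sum>d\<in>compatible n m p.
     \<Prod>i\<in>{1..n}. letter_weight (3 * d i + position_type p i))"
proof -
  let ?T = "{k. k < 3 * Suc m \<and> k mod 3 \<noteq> 1}"
  have "fps_nth (Sm m) n = (\<Sum>(p, c)\<in>{(p, c) \<in> colorings n (3 * Suc m). excedance_typed n p c}.
      \<Prod>i\<in>{1..n}. letter_weight (c i))"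
    unfolding strict_gf_Sm[OF refl, symmetric] by (rule strict_gf_colorings) simp
  also have "\<dots> = (\<Sum>(p, d)\<in>(SIGMA p:{p. p permutes {1..n}}. compatible n m p).
      \<Prod>i\<in>{1..n}. letter_weight (3 * d i + position_type p i))"
  proof (rule sum.reindex_bij_witness[of _ "\<lambda>(p, d). (p, coloring n p d)" "\<lambda>(p, c). (p, \<lambda>i. c i div 3)"])
    fix x assume "x \<in> {(p, c) \<in> colorings n (3 * Suc m). excedance_typed n p c}"
    then obtain p c where x: "x = (p, c)" "(p, c) \<in> colorings n (3 * Suc m)" "excedance_typed n p c" by blast
    note * = typed_coloring_div[OF x(2,3)]
    show "(case case x of (p, c) \<Rightarrow> (p, \<lambda>i. c i div 3) of (p, d) \<Rightarrow> (p, coloring n p d)) = x"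
      by (simp add: x(1) *(2))
    show "(case x of (p, c) \<Rightarrow> (p, \<lambda>i. c i div 3)) \<in> (SIGMA p:{p. p permutes {1..n}}. compatible n m p)"
      using *(1) x(2) by (simp add: x(1) colorings_def)
    have "c i = 3 * (c i div 3) + position_type p i" if "i \<in> {1..n}" for i
      using fun_cong[OF *(2), of i] that by (simp add: coloring_def)
    then show "(case case x of (p, c) \<Rightarrow> (p, \<lambda>i. c i div 3) of
        (p, d) \<Rightarrow> \<Prod>i\<in>{1..n}. letter_weight (3 * d i + position_type p i))
      = (case x of (p, c) \<Rightarrow> \<Prod>i\<in>{1..n}. letter_weight (c i))"
      unfolding x(1) prod.case by (intro prod.cong) auto
  next
    fix y assume "y \<in> (SIGMA p:{p. p permutes {1..n}}. compatible n m p)"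
    then obtain p d where y: "y = (p, d)" "p permutes {1..n}" "d \<in> compatible n m p" by blast
    show "(case y of (p, d) \<Rightarrow> (p, coloring n p d)) \<in> {(p, c) \<in> colorings n (3 * Suc m). excedance_typed n p c}"
      using coloring_typed[OF y(2,3)] by (simp add: y(1))
    have "coloring n p d i div 3 = d i" for i
      using y(3) coloring_div_mod(1)[of i n p d] by (cases "i \<in> {1..n}") (auto simp: coloring_def compatible_def)
    then show "(case case y of (p, d) \<Rightarrow> (p, coloring n p d) of (p, c) \<Rightarrow> (p, \<lambda>i. c i div 3)) = y"
      by (simp add: y(1))
  qed
  also have "\<dots> = (\<Sum>p | p permutes {1..n}. \<Sum>d\<in>compatible n m p.
     \<Prod>i\<in>{1..n}. letter_weight (3 * d i + position_type p i))"
    by (subst sum.Sigma) (auto simp: finite_permutations)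
  finally show ?thesis .
qed

section \<open>Descents and effective indices\<close>

text \<open>Compatible sequences complemented in \<open>m\<close>. Being weakly increasing they need
  the bound only at the last entry, which an induction on \<open>n\<close> can strip off.\<close>

definition climbs :: "nat \<Rightarrow> nat set \<Rightarrow> nat \<Rightarrow> (nat \<Rightarrow> nat) set" where
  "climbs n D m = {e. (\<forall>i. i \<notin> {1..n} \<longrightarrow> e i = 0) \<and> (1 \<le> n \<longrightarrow> e n \<le> m)
     \<and> (\<forall>i. 1 \<le> i \<and> i < n \<longrightarrow> e i \<le> e (i + 1) \<and> (i \<in> D \<longrightarrow> e i < e (i + 1)))}"

lemma climbs_mono:
  assumes "e \<in> climbs n D m" "1 \<le> i" "i \<le> j" "j \<le> n"
  shows "e i \<le> e j"
  using assms(3,4)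
proof (induction j rule: dec_induct)
  case (step j)
  then have "e j \<le> e (j + 1)" using assms(1,2) by (auto simp: climbs_def)
  then show ?case using step by simp
qed simp

lemma climbs_le:
  assumes "e \<in> climbs n D m"
  shows "e i \<le> m"
proof (cases "i \<in> {1..n}")
  case True
  then have "e i \<le> e n" "e n \<le> m" using climbs_mono[OF assms, of i n] assms by (auto simp: climbs_def)
  then show ?thesis by simp
qed (use assms in \<open>auto simp: climbs_def\<close>)

lemma finite_climbs [simp]: "finite (climbs n D m)"
proof (rule finite_subset)
  show "finite {d. \<forall>i. (i \<in> {1..n} \<longrightarrow> d i \<in> {..m}) \<and> (i \<notin> {1..n} \<longrightarrow> d i = (0::nat))}"
    by (rule finite_set_of_finite_funs) auto
  show "climbs n D m \<subseteq> {d. \<forall>i. (i \<in> {1..n} \<longrightarrow> d i \<in> {..m}) \<and> (i \<notin> {1..n} \<longrightarrow> d i = (0::nat))}"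
  proof
    fix e assume e: "e \<in> climbs n D m"
    then have "e i = 0" if "i \<notin> {1..n}" for i using that by (simp add: climbs_def)
    then show "e \<in> {d. \<forall>i. (i \<in> {1..n} \<longrightarrow> d i \<in> {..m}) \<and> (i \<notin> {1..n} \<longrightarrow> d i = (0::nat))}"
      using climbs_le[OF e] by simp
  qed
qed

lemma climbs_0: "climbs 0 D m = {\<lambda>_. 0}"
  by (auto simp: climbs_def)

text \<open>Once the last entry is \<open>m\<close>, the others form a climb of length
  \<open>n\<close> with bound \<open>m\<close>, or \<open>m - 1\<close> if step \<open>n\<close> is
  strict. A strict step up to 0 is impossible, and truncation of \<open>m - 1\<close> would miscount
  it.\<close>

lemma card_climbs_top:
  "card {e \<in> climbs (Suc n) D m. e (Suc n) = m}
    = (if 1 \<le> n \<and> n \<in> D then (if m = 0 then 0 else card (climbs n D (m - 1))) else card (climbs n D m))"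
proof (cases "1 \<le> n \<and> n \<in> D \<and> m = 0")
  case True
  then have "{e \<in> climbs (Suc n) D m. e (Suc n) = m} = {}" by (auto simp: climbs_def)
  then show ?thesis using True by simp
next
  case False
  define m' where "m' = (if 1 \<le> n \<and> n \<in> D then m - 1 else m)"
  have bound: "k \<le> m' \<longleftrightarrow> k \<le> m \<and> (n \<in> D \<longrightarrow> k < m)" if "1 \<le> n" for k
    using False that by (auto simp: m'_def)
  have "bij_betw (\<lambda>e. e(Suc n := m)) (climbs n D m') {e \<in> climbs (Suc n) D m. e (Suc n) = m}"
  proof (rule bij_betw_byWitness[where f' = "\<lambda>e. e(Suc n := 0)"])
    show "\<forall>e\<in>climbs n D m'. (e(Suc n := m))(Suc n := 0) = e"
      by (auto simp: climbs_def fun_eq_iff)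
    show "\<forall>e\<in>{e \<in> climbs (Suc n) D m. e (Suc n) = m}. (e(Suc n := 0))(Suc n := m) = e"
      by (auto simp: fun_eq_iff)
    show "(\<lambda>e. e(Suc n := m)) ` climbs n D m' \<subseteq> {e \<in> climbs (Suc n) D m. e (Suc n) = m}"
    proof (rule image_subsetI)
      fix e assume e: "e \<in> climbs n D m'"
      let ?e = "e(Suc n := m)"
      have "?e i \<le> ?e (i + 1) \<and> (i \<in> D \<longrightarrow> ?e i < ?e (i + 1))" if "1 \<le> i" "i < Suc n" for i
      proof (cases "i = n")
        case True
        then have "e n \<le> m'" using e that by (simp add: climbs_def)
        then show ?thesis using True bound[of "e n"] that by simp
      next
        case False
        then show ?thesis using e that by (auto simp: climbs_def)
      qed
      then show "?e \<in> {e \<in> climbs (Suc n) D m. e (Suc n) = m}"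
        using e by (auto simp: climbs_def)
    qed
    show "(\<lambda>e. e(Suc n := 0)) ` {e \<in> climbs (Suc n) D m. e (Suc n) = m} \<subseteq> climbs n D m'"
    proof (rule image_subsetI)
      fix e assume e: "e \<in> {e \<in> climbs (Suc n) D m. e (Suc n) = m}"
      have "e n \<le> m'" if "1 \<le> n"
      proof -
        have "\<forall>i. 1 \<le> i \<and> i < Suc n \<longrightarrow> e i \<le> e (i + 1) \<and> (i \<in> D \<longrightarrow> e i < e (i + 1))"
          using e unfolding climbs_def by blast
        then have "e n \<le> e (n + 1) \<and> (n \<in> D \<longrightarrow> e n < e (n + 1))" using that by blast
        moreover have "e (n + 1) = m" using e by simp
        ultimately show ?thesis unfolding bound[OF that] by simp
      qed
      moreover have "e i \<le> e (i + 1) \<and> (i \<in> D \<longrightarrow> e i < e (i + 1))" if "1 \<le> i" "i < n" for i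
      proof -
        have "\<forall>i. 1 \<le> i \<and> i < Suc n \<longrightarrow> e i \<le> e (i + 1) \<and> (i \<in> D \<longrightarrow> e i < e (i + 1))"
          using e unfolding climbs_def by blast
        then show ?thesis using that less_SucI by blast
      qed
      moreover have "e i = 0" if "i \<notin> {1..n}" "i \<noteq> Suc n" for i
        using e that by (auto simp: climbs_def)
      ultimately show "e(Suc n := 0) \<in> climbs n D m'" unfolding climbs_def by auto
    qed
  qed
  note card = bij_betw_same_card[OF this, symmetric]
  show ?thesis
  proof (cases "1 \<le> n \<and> n \<in> D")
    case True
    then have "m \<noteq> 0" using False by simp
    then show ?thesis unfolding card m'_def if_P[OF True] by (rule if_not_P[symmetric])
  next
    case no: False
    show ?thesis unfolding card m'_def if_not_P[OF no] ..
  qed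
qed

lemma card_climbs_Suc:
  "card (climbs (Suc n) D m) = (if m = 0 then 0 else card (climbs (Suc n) D (m - 1)))
     + card {e \<in> climbs (Suc n) D m. e (Suc n) = m}"
proof (cases "m = 0")
  case True
  then have "{e \<in> climbs (Suc n) D m. e (Suc n) = m} = climbs (Suc n) D m" by (auto simp: climbs_def)
  then show ?thesis using True by simp
next
  case False
  have "climbs (Suc n) D m = climbs (Suc n) D (m - 1) \<union> {e \<in> climbs (Suc n) D m. e (Suc n) = m}"
    using False by (auto simp: climbs_def)
  moreover have "climbs (Suc n) D (m - 1) \<inter> {e \<in> climbs (Suc n) D m. e (Suc n) = m} = {}"
    using False by (auto simp: climbs_def)
  ultimately show ?thesis
    using False card_Un_disjoint[of "climbs (Suc n) D (m - 1)" "{e \<in> climbs (Suc n) D m. e (Suc n) = m}"]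
    by simp
qed

text \<open>One factor \<open>1 - fps_X\<close> restricts the count to climbs with last entry
  exactly \<open>m\<close>; these are climbs of length \<open>n\<close>, delayed by one power of
  \<open>fps_X\<close> if step \<open>n\<close> is strict. The empty climb accounts for the
  remaining factor.\<close>

lemma climbs_gf:
  "Abs_fps (\<lambda>m. of_nat (card (climbs n D m)) :: 'a::comm_ring_1) * (1 - fps_X) ^ (n + 1)
     = fps_X ^ card {i. 1 \<le> i \<and> i < n \<and> i \<in> D}"
proof (induction n)
  case 0
  show ?case by (rule fps_ext) (auto simp: climbs_0 right_diff_distrib mult.commute)
next
  case (Suc n)
  let ?A = "\<lambda>n. Abs_fps (\<lambda>m. of_nat (card (climbs n D m)) :: 'a)"
  have "?A (Suc n) * (1 - fps_X) = fps_X ^ of_bool (1 \<le> n \<and> n \<in> D) * ?A n"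
  proof (rule fps_ext)
    fix m
    have "fps_nth (?A (Suc n) * (1 - fps_X)) m
        = of_nat (card (climbs (Suc n) D m)) - (if m = 0 then 0 else of_nat (card (climbs (Suc n) D (m - 1))))"
      by (simp add: right_diff_distrib mult.commute[of _ fps_X])
    also have "\<dots> = of_nat (card {e \<in> climbs (Suc n) D m. e (Suc n) = m})"
      by (subst card_climbs_Suc) simp
    also have "\<dots> = fps_nth (fps_X ^ of_bool (1 \<le> n \<and> n \<in> D) * ?A n) m"
      unfolding card_climbs_top by simp
    finally show "fps_nth (?A (Suc n) * (1 - fps_X)) m = fps_nth (fps_X ^ of_bool (1 \<le> n \<and> n \<in> D) * ?A n) m" .
  qed
  then have "?A (Suc n) * (1 - fps_X) ^ (Suc n + 1)
      = fps_X ^ of_bool (1 \<le> n \<and> n \<in> D) * (?A n * (1 - fps_X) ^ (n + 1))"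
    by (simp add: mult.assoc[symmetric] del: mult.assoc)
  also have "\<dots> = fps_X ^ (of_bool (1 \<le> n \<and> n \<in> D) + card {i. 1 \<le> i \<and> i < n \<and> i \<in> D})"
    by (subst Suc.IH) (simp only: power_add)
  also have "of_bool (1 \<le> n \<and> n \<in> D) + card {i. 1 \<le> i \<and> i < n \<and> i \<in> D} = card {i. 1 \<le> i \<and> i < Suc n \<and> i \<in> D}"
  proof (cases "1 \<le> n \<and> n \<in> D")
    case True
    then have "{i. 1 \<le> i \<and> i < Suc n \<and> i \<in> D} = insert n {i. 1 \<le> i \<and> i < n \<and> i \<in> D}" by auto
    then show ?thesis using True by simp
  next
    case False
    then have "{i. 1 \<le> i \<and> i < Suc n \<and> i \<in> D} = {i. 1 \<le> i \<and> i < n \<and> i \<in> D}"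
      by (auto simp: less_Suc_eq)
    then show ?thesis using False by auto
  qed
  finally show ?case .
qed

lemma card_compatible:
  assumes p: "p permutes {1..n}"
  shows "card (compatible n m p) = card (climbs n {i. p i > p (i + 1)} m)"
proof (rule bij_betw_same_card)
  define flip where "flip e i = (if i \<in> {1..n} then m - e i else (0::nat))" for e i
  have flip_flip: "flip (flip d) = d" if "\<forall>i. i \<notin> {1..n} \<longrightarrow> d i = 0" "\<And>i. d i \<le> m" for d
  proof
    show "flip (flip d) i = d i" for i
    proof (cases "i \<in> {1..n}")
      case True
      then show ?thesis using that(2)[of i] by (simp add: flip_def)
    next
      case False
      then have "flip (flip d) i = 0" unfolding flip_def by (rule if_not_P)
      then show ?thesis using that(1) False by simp
    qed
  qed
  let ?climbs = "climbs n {i. p i > p (i + 1)} m"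
  show "bij_betw flip (compatible n m p) ?climbs"
  proof (rule bij_betw_byWitness[where f' = flip])
    have "d i \<le> m" if "d \<in> compatible n m p" for d i
      using that by (cases "i \<in> {1..n}") (simp_all add: compatible_def)
    then show "\<forall>d\<in>compatible n m p. flip (flip d) = d"
      using flip_flip by (simp add: compatible_def)
    have "\<forall>i. i \<notin> {1..n} \<longrightarrow> e i = 0" if "e \<in> ?climbs" for e
      using that unfolding climbs_def by blast
    then show "\<forall>e\<in>?climbs. flip (flip e) = e"
      using flip_flip climbs_le by blast
    show "flip ` compatible n m p \<subseteq> ?climbs"
    proof (rule image_subsetI)
      fix d assume d: "d \<in> compatible n m p"
      have "flip d i \<le> flip d (i + 1) \<and> (p i > p (i + 1) \<longrightarrow> flip d i < flip d (i + 1))"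
        if "1 \<le> i" "i < n" for i
      proof -
        have "d (i + 1) \<le> d i \<and> (p i > p (i + 1) \<longrightarrow> d (i + 1) < d i)" "d i \<le> m"
          using d that by (simp_all add: compatible_def)
        moreover have "flip d i = m - d i" "flip d (i + 1) = m - d (i + 1)"
          using that by (simp_all add: flip_def)
        ultimately show ?thesis by linarith
      qed
      moreover have "flip d n \<le> m" "\<forall>i. i \<notin> {1..n} \<longrightarrow> flip d i = 0" by (auto simp: flip_def)
      ultimately show "flip d \<in> ?climbs" by (simp add: climbs_def)
    qed
    show "flip ` ?climbs \<subseteq> compatible n m p"
    proof (rule image_subsetI)
      fix e assume e: "e \<in> ?climbs"
      have "flip e (i + 1) \<le> flip e i \<and> (p i > p (i + 1) \<longrightarrow> flip e (i + 1) < flip e i)"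
        if "1 \<le> i" "i < n" for i
      proof -
        have "e i \<le> e (i + 1) \<and> (p i > p (i + 1) \<longrightarrow> e i < e (i + 1))"
          using e that by (simp add: climbs_def)
        moreover have "flip e i = m - e i" "flip e (i + 1) = m - e (i + 1)"
          using that by (simp_all add: flip_def)
        ultimately show ?thesis using climbs_le[OF e, of "i + 1"] by linarith
      qed
      moreover have "\<forall>i\<in>{1..n}. flip e i \<le> m" "\<forall>i. i \<notin> {1..n} \<longrightarrow> flip e i = 0"
        by (auto simp: flip_def)
      ultimately show "flip e \<in> compatible n m p" by (simp add: compatible_def)
    qed
  qed
qed

lemma des_gf_nth:
  assumes "p permutes {1..n}"
  shows "fps_nth (fps_X ^ des n p * recip ((1 - fps_X) ^ (n + 1))) m
       = (of_nat (card (compatible n m p)) :: 'a::comm_ring_1)"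
proof -
  let ?A = "Abs_fps (\<lambda>m. of_nat (card (climbs n {i. p i > p (i + 1)} m)) :: 'a)"
  have "?A * ((1 - fps_X) ^ (n + 1) * recip ((1 - fps_X) ^ (n + 1)))
      = fps_X ^ des n p * recip ((1 - fps_X) ^ (n + 1))"
    unfolding mult.assoc[symmetric] climbs_gf by (simp add: des_def)
  moreover have "(1 - fps_X) ^ (n + 1) * recip ((1 - fps_X) ^ (n + 1)) = (1 :: 'a fps)"
    by (rule mult_recip) (simp add: fps_power_zeroth)
  ultimately have "?A = fps_X ^ des n p * recip ((1 - fps_X) ^ (n + 1))" by simp
  then show ?thesis by (simp add: card_compatible[OF assms] fps_eq_iff)
qed

section \<open>Monomials of compatible sequences under the operator rho\<close>

definition letter_monom :: "(nat \<Rightarrow> nat) \<Rightarrow> (nat \<Rightarrow> nat) \<Rightarrow> nat \<Rightarrow> monom" where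
  "letter_monom p d i = (if i < p i then Poly_Mapping.single (X (d i)) 1
     else if p i = i then Poly_Mapping.single R 1 + Poly_Mapping.single (Z (d i)) 1
     else Poly_Mapping.single (Y (d i)) 1)"

definition word_monom :: "nat \<Rightarrow> (nat \<Rightarrow> nat) \<Rightarrow> (nat \<Rightarrow> nat) \<Rightarrow> monom" where
  "word_monom n p d = (\<Sum>i\<in>{1..n}. letter_monom p d i)"

lemma mono_add: "mono (A + B) = mono A * mono B"
  by (simp add: mono_def mult_single)

lemma mono_sum: "mono (\<Sum>i\<in>A. f i) = (\<Prod>i\<in>A. mono (f i))"
proof (induction A rule: infinite_finite_induct)
  case (insert x A)
  then show ?case by (simp add: mono_add)
qed (simp_all add: mono_def)

lemma letter_weight_mono: "letter_weight (3 * d i + position_type p i) = mono (letter_monom p d i)"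
  by (auto simp: position_type_def letter_monom_def mono_add V_def mono_def mult_single)

lemma prod_letter_weight:
  "(\<Prod>i\<in>{1..n}. letter_weight (3 * d i + position_type p i)) = mono (word_monom n p d)"
  by (simp add: letter_weight_mono word_monom_def mono_sum)

lemma rho_superset:
  assumes "finite A" "Poly_Mapping.keys q \<subseteq> A"
  shows "rho q = (\<Sum>M\<in>A. of_int (Poly_Mapping.lookup q M) * V S ^ eff M * V R ^ Poly_Mapping.lookup M R)"
  unfolding rho_def using assms
  by (intro sum.mono_neutral_left) (auto simp: in_keys_iff)

lemma rho_add: "rho (p + q) = rho p + rho q"
proof -
  let ?A = "Poly_Mapping.keys p \<union> Poly_Mapping.keys q"
  have "Poly_Mapping.keys (p + q) \<subseteq> ?A" by (rule keys_add)
  then show ?thesis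
    using rho_superset[of ?A "p + q"] rho_superset[of ?A p] rho_superset[of ?A q]
    by (simp add: lookup_add distrib_right sum.distrib)
qed

lemma rho_sum: "rho (\<Sum>i\<in>A. f i) = (\<Sum>i\<in>A. rho (f i))"
proof (induction A rule: infinite_finite_induct)
  case (insert x A)
  then show ?case by (simp add: rho_add)
qed (simp_all add: rho_def)

lemma rho_mono: "rho (mono M) = V S ^ eff M * V R ^ Poly_Mapping.lookup M R"
  by (simp add: rho_def mono_def)

lemma contains_word_monom:
  "contains (word_monom n p d) v \<longleftrightarrow> (\<exists>i\<in>{1..n}. contains (letter_monom p d i) v)"
  by (auto simp: contains_def word_monom_def lookup_sum sum_eq_0_iff simp flip: neq0_conv)

lemma contains_X: "contains (word_monom n p d) (X k) \<longleftrightarrow> (\<exists>i\<in>{1..n}. i < p i \<and> d i = k)"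
  unfolding contains_word_monom
  by (intro bex_cong refl) (auto simp: contains_def letter_monom_def lookup_add lookup_single when_def)

lemma contains_YZ:
  "contains (word_monom n p d) (Y k) \<or> contains (word_monom n p d) (Z k)
     \<longleftrightarrow> (\<exists>i\<in>{1..n}. p i \<le> i \<and> d i = k)"
  unfolding contains_word_monom bex_disj_distrib[symmetric]
  by (intro bex_cong refl) (auto simp: contains_def letter_monom_def lookup_add lookup_single when_def)

lemma lookup_R: "Poly_Mapping.lookup (word_monom n p d) R = fixcount n p"
proof -
  have "Poly_Mapping.lookup (letter_monom p d i) R = (if p i = i then 1 else 0)" for i
    by (auto simp: letter_monom_def lookup_add lookup_single when_def)
  then have "Poly_Mapping.lookup (word_monom n p d) R = card {i \<in> {1..n}. p i = i}"
    by (simp add: word_monom_def lookup_sum sum.If_cases Int_def)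
  then show ?thesis by (simp add: fixcount_def)
qed

lemma effective_word_monom:
  "effective (word_monom n p d) v \<longleftrightarrow> (\<exists>i\<in>{1..n}. p i \<le> i \<and> d i = v) \<and>
     (\<exists>k>v. (\<exists>i\<in>{1..n}. i < p i \<and> d i = k) \<and>
        (\<forall>i\<in>{1..n}. p i \<le> i \<longrightarrow> \<not> (v < d i \<and> d i < k)))"
  unfolding effective_def contains_YZ contains_X de_Morgan_disj[symmetric] by blast

text \<open>The bijection sends a crossing descent \<open>i\<close> to the value
  \<open>d (i + 1)\<close>. It is injective because \<open>d\<close> drops at each crossing
  descent.\<close>

lemma eff_word_monom:
  assumes p: "p permutes {1..n}" and d: "d \<in> compatible n m p"
  shows "eff (word_monom n p d) = xdes n p"
proof -
  let ?D = "{i. 1 \<le> i \<and> i < n \<and> p i \<ge> i + 1 \<and> i + 1 \<ge> p (i + 1)}"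
  have chain: "d j \<le> d i" "d i = d j \<Longrightarrow> p i + j \<le> p j + i" if "1 \<le> i" "i \<le> j" "j \<le> n" for i j
    using compatible_chain[OF p d that] by blast+
  have drop: "d (i + 1) < d i" if "i \<in> ?D" for i
  proof -
    have "p i \<noteq> p (i + 1)" using injD[OF permutes_inj[OF p], of i "i + 1"] by linarith
    then have "p i > p (i + 1)" using that by auto
    then show ?thesis using d that by (auto simp: compatible_def)
  qed
  have inj: "inj_on (\<lambda>i. d (i + 1)) ?D"
  proof (rule linorder_inj_onI)
    fix i j assume ij: "i < j" "i \<in> ?D" "j \<in> ?D"
    then have "d j \<le> d (i + 1)" by (intro chain) auto
    then show "d (i + 1) \<noteq> d (j + 1)" using drop[OF ij(3)] by linarith
  qed auto
  have image: "(\<lambda>i. d (i + 1)) ` ?D = {v. effective (word_monom n p d) v}"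
  proof (intro equalityI subsetI)
    fix v assume "v \<in> (\<lambda>i. d (i + 1)) ` ?D"
    then obtain i where i: "i \<in> ?D" "v = d (i + 1)" by blast
    \<comment> \<open>The witness for \<open>k\<close> is \<open>d i\<close>: since \<open>d\<close>
      weakly decreases and \<open>i\<close>, \<open>i + 1\<close> are adjacent, no value lies
      strictly between.\<close>
    have "\<not> (v < d j \<and> d j < d i)" if "j \<in> {1..n}" for j
      using chain(1)[of j i] chain(1)[of "i + 1" j] that i by (cases "j \<le> i") auto
    moreover have "\<exists>j\<in>{1..n}. p j \<le> j \<and> d j = v" using i by (intro bexI[of _ "i + 1"]) auto
    moreover have "\<exists>j\<in>{1..n}. j < p j \<and> d j = d i" using i by (intro bexI[of _ i]) auto
    moreover have "d i > v" using drop[OF i(1)] i(2) by simp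
    ultimately show "v \<in> {v. effective (word_monom n p d) v}"
      unfolding mem_Collect_eq effective_word_monom by blast
  next
    fix v assume "v \<in> {v. effective (word_monom n p d) v}"
    then obtain k b where ex: "\<exists>i. i \<in> {1..n} \<and> p i \<le> i \<and> d i = v"
      and b: "k > v" "b \<in> {1..n}" "b < p b" "d b = k"
      and gap: "\<And>i. i \<in> {1..n} \<Longrightarrow> p i \<le> i \<Longrightarrow> \<not> (v < d i \<and> d i < k)"
      unfolding mem_Collect_eq effective_word_monom by blast
    \<comment> \<open>The first non-excedance of value \<open>v\<close>; its predecessor will be the
      crossing descent.\<close>
    define a where "a = (LEAST i. i \<in> {1..n} \<and> p i \<le> i \<and> d i = v)"
    have a: "a \<in> {1..n}" "p a \<le> a" "d a = v"
      using LeastI_ex[OF ex] unfolding a_def by blast+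
    have min: "\<not> (i \<in> {1..n} \<and> p i \<le> i \<and> d i = v)" if "i < a" for i
      using not_less_Least that unfolding a_def by blast
    have ba: "b < a" using chain(1)[of a b] a b by (cases "b < a") auto
    define i where "i = a - 1"
    have i: "i \<in> {1..n}" "b \<le> i" "i < a" "a = i + 1" using ba b(2) a(1) by (auto simp: i_def)
    have di: "v \<le> d i" "d i \<le> k" using chain(1)[of i a] chain(1)[of b i] i a b by auto
    have "i < p i"
    proof (rule ccontr)
      assume ni: "\<not> i < p i"
      then have "d i \<noteq> v" using min[OF i(3)] i(1) by auto
      then have "d i = k" using gap[OF i(1)] ni di by auto
      \<comment> \<open>The value is \<open>k\<close> on the whole stretch from \<open>b\<close> to
        \<open>i\<close>, so \<open>p i - i\<close> is at least \<open>p b - b\<close>: the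
        excedance at \<open>b\<close> forces one at \<open>i\<close>.\<close>
      then have "p b + i \<le> p i + b" using chain(2)[of b i] i b by auto
      then show False using b(3) ni by linarith
    qed
    then have "i \<in> ?D" "v = d (i + 1)" using i a by auto
    then show "v \<in> (\<lambda>i. d (i + 1)) ` ?D" by blast
  qed
  show ?thesis
    unfolding eff_def xdes_def image[symmetric] by (rule card_image[OF inj])
qed

theorem theorem3p3:
  shows "Fser = RHSser"
proof (rule fps_ext, rule fps_ext)
  fix n m
  have "fps_nth (fps_nth RHSser n) m = (\<Sum>p | p permutes {1..n}. \<Sum>d\<in>compatible n m p.
      rho (mono (word_monom n p d)))"
    unfolding RHSser_def fps_nth_Abs_fps Sm_nth prod_letter_weight rho_sum ..
  \<comment> \<open>After \<open>rho\<close> the term no longer depends on \<open>d\<close>, so the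
    inner sum only counts compatible sequences.\<close>
  also have "\<dots> = (\<Sum>p | p permutes {1..n}. \<Sum>d\<in>compatible n m p. V S ^ xdes n p * V R ^ fixcount n p)"
    by (intro sum.cong refl) (simp add: rho_mono eff_word_monom lookup_R)
  also have "\<dots> = (\<Sum>p | p permutes {1..n}.
      fps_nth (fps_X ^ des n p * recip ((1 - fps_X) ^ (n + 1))) m * (V S ^ xdes n p * V R ^ fixcount n p))"
  proof (rule sum.cong[OF refl])
    fix p assume "p \<in> {p. p permutes {1..n}}"
    then have p: "p permutes {1..n}" by blast
    show "(\<Sum>d\<in>compatible n m p. V S ^ xdes n p * V R ^ fixcount n p)
      = fps_nth (fps_X ^ des n p * recip ((1 - fps_X) ^ (n + 1))) m * (V S ^ xdes n p * V R ^ fixcount n p)"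
      unfolding des_gf_nth[OF p] sum_constant ..
  qed
  also have "\<dots> = (\<Sum>p | p permutes {1..n}.
      fps_nth (fps_X ^ des n p * fps_const (V S ^ xdes n p * V R ^ fixcount n p) * recip ((1 - fps_X) ^ (n + 1))) m)"
  proof (intro sum.cong refl)
    fix p
    have "fps_X ^ des n p * fps_const (V S ^ xdes n p * V R ^ fixcount n p) * recip ((1 - fps_X) ^ (n + 1))
      = fps_X ^ des n p * recip ((1 - fps_X) ^ (n + 1)) * fps_const (V S ^ xdes n p * V R ^ fixcount n p)"
      by (simp only: ac_simps)
    then show "fps_nth (fps_X ^ des n p * recip ((1 - fps_X) ^ (n + 1))) m * (V S ^ xdes n p * V R ^ fixcount n p)
      = fps_nth (fps_X ^ des n p * fps_const (V S ^ xdes n p * V R ^ fixcount n p) * recip ((1 - fps_X) ^ (n + 1))) m"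
      by (simp only: fps_mult_right_const_nth)
  qed
  also have "\<dots> = fps_nth (fps_nth Fser n) m"
    by (simp add: Fser_def sum_distrib_right fps_sum_nth)
  finally show "fps_nth (fps_nth Fser n) m = fps_nth (fps_nth RHSser n) m" ..
qed

end
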